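(* Every universal projectable ambient triplet $(\mathfrak g,\mathfrak h,\mathfrak i)$ is isomorphic to exactly one of the triplets in the following list, where $\mathfrak g=\mathrm{Span}(M)\oplus \mathrm{Span}(H)\oplus \mathbf P\oplus\mathbf K\oplus\mathbf J$, $\mathfrak h=\mathbf K\oplus\mathbf J$, $\mathfrak i=\mathrm{Span}(M)$, only the non-vanishing commutators not involving $\mathbf J$ on the left-hand side are displayed, and every member of the list is a universal projectable ambient triplet. Moreover the quotient space $\mathfrak g/\mathfrak h$ carries the indicated $\mathrm{ad}_{\mathfrak h}$-invariant metric structure. (1) $\mathsf G$-ambient family: $[\mathbf K,H]=\mathbf P$, $[H,\mathbf P]=\epsilon\,\mathbf K+\omega\,\mathbf P$, $[H,M]=\lambda M$, where $(\epsilon,\omega,\lambda)$ is one of - $(0,0,0)$ or $(0,0,1)$; - $(0,1,\lambda)$ with $\lambda\in\mathbb R$; - $(1,0,\lambda)$ with $\lambda\ge 0$; - $(-1,0,\lambda)$ with $\lambda\geq 0$; - $(1,\alpha_+,\lambda)$ with $\alpha_+>0$, $\lambda\in\mathbb R$; - $(-1,\alpha_-,\lambda)$ with $\alpha_->0$, $\lambda\in\mathbb R$. These are $\mathsf G$-ambient for $\boldsymbol\xi=M$, $\boldsymbol\psi=-H^*$, $\boldsymbol\gamma=\mathbf P^*\otimes\mathbf P^*$, $\boldsymbol A=M^*$. (2) Bargmannian family: $[\mathbf K,\mathbf P]=M$, $[\mathbf K,H]=\mathbf P$, $[H,\mathbf P]=\epsilon\,\mathbf K+\omega\,\mathbf P$,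 $[H,M]=\omega M$, where $(\epsilon,\omega)$ is one of $(0,0)$, $(0,1)$, $(1,0)$, $(-1,0)$, $(1,\alpha_+)$ with $\alpha_+>0$, $(-1,\alpha_-)$ with $\alpha_->0$. These are bargmannian for $\boldsymbol\xi=M$, $\boldsymbol\psi=-H^*$, $\boldsymbol\gamma=\mathbf P^*\otimes\mathbf P^*$ and $\boldsymbol g=-M^*\otimes H^*-H^*\otimes M^*+\mathbf P^*\otimes\mathbf P^*$. (3) carrollian $\oplus\,\mathbb R$ family ($M$ central): - $[\mathbf K,\mathbf P]=H$; - $[\mathbf K,\mathbf P]=H$, $[H,\mathbf P]=-\mathbf K$, $[\mathbf P,\mathbf P]=-\mathbf J$; - $[\mathbf K,\mathbf P]=H$, $[H,\mathbf P]=\mathbf K$, $[\mathbf P,\mathbf P]=\mathbf J$; - $[\mathbf K,\mathbf P]=H+\mathbf J$, $[H,\mathbf P]=-\mathbf P$, $[\mathbf K,H]=-\mathbf K$. These admit the $\mathrm{ad}_{\mathfrak h}$-invariants $\boldsymbol\xi=M$, $\boldsymbol A=M^*$, $\boldsymbol N=H$, $\boldsymbol\gamma=\mathbf P^*\otimes\mathbf P^*$. (4) riemannian $\oplus\,\mathbb R$ family ($M$ central): $[\mathbf K,\mathbf K]=-\mathbf J$, $[\mathbf K,\mathbf P]=H$, $[\mathbf K,H]=-\mathbf P$ together with $[H,\mathbf P]=\eta\,\mathbf K$, $[\mathbf P,\mathbf P]=\eta\,\mathbf J$, with $\eta\in\{0,-1,1\}$. These admit the $\mathrm{ad}_{\mathfrak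 h}$-invariants $\boldsymbol\xi=M$, $\boldsymbol A=M^*$, $\boldsymbol g=H^*\otimes H^*+\mathbf P^*\otimes\mathbf P^*$. (5) lorentzian $\oplus\,\mathbb R$ family ($M$ central): $[\mathbf K,\mathbf K]=\mathbf J$, $[\mathbf K,\mathbf P]=H$, $[\mathbf K,H]=\mathbf P$ together with $[H,\mathbf P]=\eta\,\mathbf K$, $[\mathbf P,\mathbf P]=\eta\,\mathbf J$, with $\eta\in\{0,-1,1\}$. These admit the $\mathrm{ad}_{\mathfrak h}$-invariants $\boldsymbol\xi=M$, $\boldsymbol A=M^*$, $\boldsymbol g=-H^*\otimes H^*+\mathbf P^*\otimes\mathbf P^*$.
   Context: All Lie algebras are real and finite-dimensional. A Klein pair is a pair $(\mathfrak g,\mathfrak h)$ of a Lie algebra and a Lie subalgebra; it is effective if $\mathfrak h$ contains no non-zero ideal of $\mathfrak g$. Ambient aristotelian algebra with $d$-dimensional spatial isotropy: a Lie algebra $\mathfrak g$ with basis $M,H,P_i,K_i,J_{ij}=-J_{ji}$ ($1\le i,j\le d$), where $[J_{ij},J_{kl}]=\delta_{jk}J_{il}-\delta_{jl}J_{ik}+\delta_{il}J_{jk}-\delta_{ik}J_{jl}$ (so $\mathbf J=\mathrm{Span}\{J_{ij}\}\simeq\mathfrak{so}(d)$), $[J_{ij},V_k]=-\delta_{ik}V_j+\delta_{jk}V_i$ for $V=P,K$ (vector modules $\mathbf P$, $\mathbf K$), and $[J_{ij},M]=[J_{ij},H]=0$ (scalar modules). An ambient aristotelian Klein pair is a Klein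 pair $(\mathfrak g,\mathfrak h)$ where $\mathfrak g$ is an ambient aristotelian algebra with $d$-dimensional spatial isotropy and $\mathfrak h$ is a subalgebra which is the sum of $\mathbf J$ and one vector module; the basis is chosen so that $\mathfrak h=\mathbf K\oplus\mathbf J$. A projectable ambient triplet $(\mathfrak g,\mathfrak h,\mathfrak i)$ consists of an effective ambient aristotelian Klein pair $(\mathfrak g,\mathfrak h)$ and a one-dimensional ideal $\mathfrak i\subset\mathfrak g$ spanned by an element of the scalar part $\mathrm{Span}\{M,H\}$ (the basis is chosen so that $\mathfrak i=\mathrm{Span}(M)$), such that the quotient Klein pair $(\mathfrak g/\mathfrak i,\mathfrak h)$ is effective (here $\mathfrak h\cap\mathfrak i=0$, and $\mathfrak h$ is identified with its image in $\mathfrak g/\mathfrak i$). Universal: a sequence of projectable ambient triplets indexed by the integer $d\ge1$, whose commutators take the same form for every $d$, without dimension-specific structure. That is, the commutators not involving $\mathbf J$ on the left are given by real coefficients independent of $d$, with the bracket of two scalars a combination of $M,H$; the bracket of a scalar with $K_i$ (or $P_i$) a combination of $K_i,P_i$; $[K_i,P_j]=\delta_{ij}(aH+bM)+cJ_{ij}$; $[K_i,K_j]=e\,J_{ij}$; $[P_i,P_j]=f\,J_{ij}$. Shorthand: $[\mathbf K,H]=\mathbf P$ means $[K_i,H]=P_i$; $[\mathbf K,\mathbf P]=H+\mathbf J$ means $[K_i,P_j]=\delta_{ij}H+J_{ij}$; $[\mathbf K,\mathbf K]=\mathbf J$ means $[K_i,K_j]=J_{ij}$; etc. Isomorphism of triplets: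 a Lie algebra isomorphism $\varphi:\mathfrak g_1\to\mathfrak g_2$ with $\varphi(\mathfrak h_1)=\mathfrak h_2$, $\varphi(\mathfrak i_1)=\mathfrak i_2$, preserving the $\mathfrak{so}(d)$-decomposition (mapping $\mathbf J_1$ to $\mathbf J_2$, the sum of scalar modules to the sum of scalar modules, and the sum of vector modules to the sum of vector modules). Universal triplets are isomorphic if they are so for every $d$. Metric structures: $\mathfrak h$ acts on $\mathfrak g/\mathfrak h$ by the action induced from the adjoint action, and on tensors; invariance refers to this action. Elements of $\mathfrak g/\mathfrak h$ are identified with elements of $\mathrm{Span}\{M,H,P_i\}$, with dual basis $M^*,H^*,P^*_i$, and $\mathbf P^*\otimes\mathbf P^*=\sum_iP_i^*\otimes P_i^*$. The Klein pair is leibnizian for $(\boldsymbol\xi,\boldsymbol\psi,\boldsymbol\gamma)$ if $\boldsymbol\xi\in\mathfrak g/\mathfrak h$ is a non-zero invariant vector, $\boldsymbol\psi\in(\mathfrak g/\mathfrak h)^*$ is a non-zero invariant linear form with $\boldsymbol\psi(\boldsymbol\xi)=0$, and $\boldsymbol\gamma$ is a symmetric positive semi-definite invariant bilinear form on $\ker\boldsymbol\psi$ with radical spanned by $\boldsymbol\xi$. It is $\mathsf G$-ambient if in addition there is an invariant linear form $\boldsymbol A\in(\mathfrak g/\mathfrak h)^*$ with $\boldsymbol A(\boldsymbol\xi)=1$; it is bargmannian if in addition there is an invariant symmetric bilinear form $\boldsymbol g$ on $\mathfrak g/\mathfrak h$ with $\boldsymbol g(\boldsymbol\xi,-)=\boldsymbol\psi$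 and $\boldsymbol g|_{\ker\boldsymbol\psi}=\boldsymbol\gamma$. *)

theory Defs
  imports "HOL-Analysis.Analysis" "HOL-Analysis.Finite_Function_Topology"
begin

subsection \<open>Lie algebras, Klein pairs and quotients\<close>

text \<open>A Lie algebra is a finite-dimensional subspace of some real vector space together with a
  bracket, of which only the restriction to that subspace matters.\<close>

definition lie_algebra :: "'a::real_vector set \<Rightarrow> ('a \<Rightarrow> 'a \<Rightarrow> 'a) \<Rightarrow> bool" where
  "lie_algebra g br \<longleftrightarrow>
     subspace g \<and> (\<exists>B. finite B \<and> g = span B) \<and>
     (\<forall>x\<in>g. \<forall>y\<in>g. br x y \<in> g) \<and>
     (\<forall>x\<in>g. \<forall>y\<in>g. \<forall>z\<in>g. br (x + y) z = br x z + br y z \<and> br z (x + y) = br z x + br z y) \<and>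
     (\<forall>r. \<forall>x\<in>g. \<forall>y\<in>g. br (r *\<^sub>R x) y = r *\<^sub>R br x y \<and> br x (r *\<^sub>R y) = r *\<^sub>R br x y) \<and>
     (\<forall>x\<in>g. br x x = 0) \<and>
     (\<forall>x\<in>g. \<forall>y\<in>g. \<forall>z\<in>g. br x (br y z) + br y (br z x) + br z (br x y) = 0)"

definition klein_pair :: "'a::real_vector set \<Rightarrow> ('a \<Rightarrow> 'a \<Rightarrow> 'a) \<Rightarrow> 'a set \<Rightarrow> bool" where
  "klein_pair g br h \<longleftrightarrow>
     lie_algebra g br \<and> subspace h \<and> h \<subseteq> g \<and> (\<forall>x\<in>h. \<forall>y\<in>h. br x y \<in> h)"

text \<open>The points of a quotient are cosets, which do not form a type of class
  \<open>real_vector\<close>; the notions needed for quotients are therefore stated for spaces with explicit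
  operations.\<close>

record 'v space =
  points :: "'v set"
  origin :: 'v
  plus_of :: "'v \<Rightarrow> 'v \<Rightarrow> 'v"
  scale_of :: "real \<Rightarrow> 'v \<Rightarrow> 'v"

record 'v lie_space = "'v space" +
  bracket_of :: "'v \<Rightarrow> 'v \<Rightarrow> 'v"

definition lie_space_of :: "'a::real_vector set \<Rightarrow> ('a \<Rightarrow> 'a \<Rightarrow> 'a) \<Rightarrow> 'a lie_space" where
  "lie_space_of g br =
     \<lparr>points = g, origin = 0, plus_of = (+), scale_of = (*\<^sub>R), bracket_of = br\<rparr>"

definition coset :: "'a::real_vector set \<Rightarrow> 'a \<Rightarrow> 'a set" where
  "coset s x = {x + y | y. y \<in> s}"

definition quotient_space :: "'a::real_vector set \<Rightarrow> 'a set \<Rightarrow> 'a set space" where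
  "quotient_space g s =
     \<lparr>points = coset s ` g,
      origin = s,
      plus_of = (\<lambda>A B. {a + b | a b. a \<in> A \<and> b \<in> B}),
      scale_of = (\<lambda>r A. \<Union>a\<in>A. coset s (r *\<^sub>R a))\<rparr>"

definition quotient_lie ::
  "'a::real_vector set \<Rightarrow> ('a \<Rightarrow> 'a \<Rightarrow> 'a) \<Rightarrow> 'a set \<Rightarrow> 'a set lie_space" where
  "quotient_lie g br s =
     space.extend (quotient_space g s)
       (lie_space.fields (\<lambda>A B. \<Union>a\<in>A. \<Union>b\<in>B. coset s (br a b)))"

definition lie_ideal :: "'v lie_space \<Rightarrow> 'v set \<Rightarrow> bool" where
  "lie_ideal L a \<longleftrightarrow>
     a \<subseteq> points L \<and> origin L \<in> a \<and>
     (\<forall>x\<in>a. \<forall>y\<in>a. plus_of L x y \<in> a) \<and>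
     (\<forall>r. \<forall>x\<in>a. scale_of L r x \<in> a) \<and>
     (\<forall>x\<in>points L. \<forall>y\<in>a. bracket_of L x y \<in> a)"

definition effective :: "'v lie_space \<Rightarrow> 'v set \<Rightarrow> bool" where
  "effective L h \<longleftrightarrow> (\<forall>a. lie_ideal L a \<and> a \<subseteq> h \<longrightarrow> a = {origin L})"


subsection \<open>Projectable ambient triplets\<close>

datatype gen = genM | genH | genP nat | genK nat | genJ nat nat

abbreviation Pgens :: "nat \<Rightarrow> gen set" where "Pgens d \<equiv> genP ` {1..d}"
abbreviation Kgens :: "nat \<Rightarrow> gen set" where "Kgens d \<equiv> genK ` {1..d}"

text \<open>Only the \<open>J\<^sub>i\<^sub>j\<close> with \<open>i < j\<close> are basis elements.\<close>

abbreviation Jgens :: "nat \<Rightarrow> gen set" where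
  "Jgens d \<equiv> {genJ i j | i j. 1 \<le> i \<and> i < j \<and> j \<le> d}"

definition gens :: "nat \<Rightarrow> gen set" where
  "gens d = {genM, genH} \<union> Pgens d \<union> Kgens d \<union> Jgens d"

definition frame :: "nat \<Rightarrow> 'a::real_vector set \<Rightarrow> (gen \<Rightarrow> 'a) \<Rightarrow> bool" where
  "frame d g e \<longleftrightarrow>
     inj_on e (gens d) \<and> independent (e ` gens d) \<and> span (e ` gens d) = g \<and>
     (\<forall>i\<in>{1..d}. \<forall>j\<in>{1..d}. e (genJ i j) = - e (genJ j i))"

abbreviation kdelta :: "nat \<Rightarrow> nat \<Rightarrow> real" where
  "kdelta i j \<equiv> of_bool (i = j)"

definition ambient_aristotelian ::
  "nat \<Rightarrow> 'a::real_vector set \<Rightarrow> ('a \<Rightarrow> 'a \<Rightarrow> 'a) \<Rightarrow> (gen \<Rightarrow> 'a) \<Rightarrow> bool" where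
  "ambient_aristotelian d g br e \<longleftrightarrow>
     lie_algebra g br \<and> frame d g e \<and>
     (\<forall>i\<in>{1..d}. \<forall>j\<in>{1..d}. \<forall>k\<in>{1..d}. \<forall>l\<in>{1..d}.
        br (e (genJ i j)) (e (genJ k l)) =
          kdelta j k *\<^sub>R e (genJ i l) - kdelta j l *\<^sub>R e (genJ i k)
          + kdelta i l *\<^sub>R e (genJ j k) - kdelta i k *\<^sub>R e (genJ j l)) \<and>
     (\<forall>i\<in>{1..d}. \<forall>j\<in>{1..d}. \<forall>k\<in>{1..d}.
        br (e (genJ i j)) (e (genP k)) =
          - kdelta i k *\<^sub>R e (genP j) + kdelta j k *\<^sub>R e (genP i) \<and>
        br (e (genJ i j)) (e (genK k)) =
          - kdelta i k *\<^sub>R e (genK j) + kdelta j k *\<^sub>R e (genK i)) \<and>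
     (\<forall>i\<in>{1..d}. \<forall>j\<in>{1..d}.
        br (e (genJ i j)) (e genM) = 0 \<and> br (e (genJ i j)) (e genH) = 0)"

text \<open>A triplet carries, besides \<open>(g, h, i)\<close>, the sums of its scalar modules, of its vector modules,
  and the rotations, since isomorphisms must preserve these subspaces. The basis is not part of
  the data.\<close>

record 'a triplet =
  algebra :: "'a set"
  bracket :: "'a \<Rightarrow> 'a \<Rightarrow> 'a"
  isotropy :: "'a set"
  ideal_part :: "'a set"
  scalars :: "'a set"
  vectors :: "'a set"
  rotations :: "'a set"

definition adapted_basis :: "nat \<Rightarrow> 'a::real_vector triplet \<Rightarrow> (gen \<Rightarrow> 'a) \<Rightarrow> bool" where
  "adapted_basis d T e \<longleftrightarrow>
     ambient_aristotelian d (algebra T) (bracket T) e \<and>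
     scalars T = span {e genM, e genH} \<and>
     vectors T = span (e ` (Pgens d \<union> Kgens d)) \<and>
     rotations T = span (e ` Jgens d) \<and>
     isotropy T = span (e ` (Kgens d \<union> Jgens d)) \<and>
     ideal_part T = span {e genM}"

definition projectable_triplet :: "nat \<Rightarrow> 'a::real_vector triplet \<Rightarrow> bool" where
  "projectable_triplet d T \<longleftrightarrow>
     (\<exists>e. adapted_basis d T e) \<and>
     klein_pair (algebra T) (bracket T) (isotropy T) \<and>
     effective (lie_space_of (algebra T) (bracket T)) (isotropy T) \<and>
     lie_ideal (lie_space_of (algebra T) (bracket T)) (ideal_part T) \<and>
     effective (quotient_lie (algebra T) (bracket T) (ideal_part T))
       (coset (ideal_part T) ` isotropy T)"

text \<open>The coefficients allowed in universal commutators: for instance \<open>hp_K\<close> is the coefficient of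
  \<open>K\<^sub>i\<close> in \<open>[H, P\<^sub>i]\<close> and \<open>kp_H\<close> that of \<open>H\<close> in \<open>[K\<^sub>i, P\<^sub>i]\<close>.\<close>

record coeffs =
  hm_H :: real  hm_M :: real
  kh_K :: real  kh_P :: real
  hp_K :: real  hp_P :: real
  mk_K :: real  mk_P :: real
  mp_K :: real  mp_P :: real
  kp_H :: real  kp_M :: real  kp_J :: real
  kk_J :: real
  pp_J :: real

definition commutators ::
  "nat \<Rightarrow> ('a::real_vector \<Rightarrow> 'a \<Rightarrow> 'a) \<Rightarrow> (gen \<Rightarrow> 'a) \<Rightarrow> coeffs \<Rightarrow> bool" where
  "commutators d br e c \<longleftrightarrow>
     br (e genH) (e genM) = hm_H c *\<^sub>R e genH + hm_M c *\<^sub>R e genM \<and>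
     (\<forall>i\<in>{1..d}.
        br (e (genK i)) (e genH) = kh_K c *\<^sub>R e (genK i) + kh_P c *\<^sub>R e (genP i) \<and>
        br (e genH) (e (genP i)) = hp_K c *\<^sub>R e (genK i) + hp_P c *\<^sub>R e (genP i) \<and>
        br (e genM) (e (genK i)) = mk_K c *\<^sub>R e (genK i) + mk_P c *\<^sub>R e (genP i) \<and>
        br (e genM) (e (genP i)) = mp_K c *\<^sub>R e (genK i) + mp_P c *\<^sub>R e (genP i)) \<and>
     (\<forall>i\<in>{1..d}. \<forall>j\<in>{1..d}.
        br (e (genK i)) (e (genP j)) =
          kdelta i j *\<^sub>R (kp_H c *\<^sub>R e genH + kp_M c *\<^sub>R e genM) + kp_J c *\<^sub>R e (genJ i j) \<and>
        br (e (genK i)) (e (genK j)) = kk_J c *\<^sub>R e (genJ i j) \<and>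
        br (e (genP i)) (e (genP j)) = pp_J c *\<^sub>R e (genJ i j))"

text \<open>A sequence is indexed by \<open>d \<ge> 1\<close>; its value at \<open>0\<close> is irrelevant.\<close>

definition universal_triplet :: "(nat \<Rightarrow> 'a::real_vector triplet) \<Rightarrow> bool" where
  "universal_triplet T \<longleftrightarrow>
     (\<forall>d\<ge>1. projectable_triplet d (T d)) \<and>
     (\<exists>c. \<forall>d\<ge>1. \<exists>e. adapted_basis d (T d) e \<and> commutators d (bracket (T d)) e c)"

definition triplet_iso ::
  "('a::real_vector \<Rightarrow> 'b::real_vector) \<Rightarrow> 'a triplet \<Rightarrow> 'b triplet \<Rightarrow> bool" where
  "triplet_iso \<phi> T T' \<longleftrightarrow>
     bij_betw \<phi> (algebra T) (algebra T') \<and>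
     (\<forall>x\<in>algebra T. \<forall>y\<in>algebra T. \<phi> (x + y) = \<phi> x + \<phi> y) \<and>
     (\<forall>r. \<forall>x\<in>algebra T. \<phi> (r *\<^sub>R x) = r *\<^sub>R \<phi> x) \<and>
     (\<forall>x\<in>algebra T. \<forall>y\<in>algebra T. \<phi> (bracket T x y) = bracket T' (\<phi> x) (\<phi> y)) \<and>
     \<phi> ` isotropy T = isotropy T' \<and> \<phi> ` ideal_part T = ideal_part T' \<and>
     \<phi> ` rotations T = rotations T' \<and> \<phi> ` scalars T = scalars T' \<and>
     \<phi> ` vectors T = vectors T'"

definition universally_isomorphic ::
  "(nat \<Rightarrow> 'a::real_vector triplet) \<Rightarrow> (nat \<Rightarrow> 'b::real_vector triplet) \<Rightarrow> bool" where
  "universally_isomorphic T T' \<longleftrightarrow> (\<forall>d\<ge>1. \<exists>\<phi>. triplet_iso \<phi> (T d) (T' d))"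


subsection \<open>The triplet with given coefficients\<close>

type_synonym vec = "gen \<Rightarrow>\<^sub>0 real"

text \<open>The vector of coordinates of a generator, with \<open>J\<^sub>i\<^sub>j = - J\<^sub>j\<^sub>i\<close>.\<close>

fun E :: "gen \<Rightarrow> vec" where
  "E (genJ i j) =
     (if i < j then Poly_Mapping.single (genJ i j) 1
      else if j < i then - Poly_Mapping.single (genJ j i) 1 else 0)"
| "E a = Poly_Mapping.single a 1"

fun gen_bracket :: "coeffs \<Rightarrow> gen \<Rightarrow> gen \<Rightarrow> vec" where
  "gen_bracket c genH genM = hm_H c *\<^sub>R E genH + hm_M c *\<^sub>R E genM"
| "gen_bracket c genM genH = - (hm_H c *\<^sub>R E genH + hm_M c *\<^sub>R E genM)"
| "gen_bracket c (genK i) genH = kh_K c *\<^sub>R E (genK i) + kh_P c *\<^sub>R E (genP i)"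
| "gen_bracket c genH (genK i) = - (kh_K c *\<^sub>R E (genK i) + kh_P c *\<^sub>R E (genP i))"
| "gen_bracket c genH (genP i) = hp_K c *\<^sub>R E (genK i) + hp_P c *\<^sub>R E (genP i)"
| "gen_bracket c (genP i) genH = - (hp_K c *\<^sub>R E (genK i) + hp_P c *\<^sub>R E (genP i))"
| "gen_bracket c genM (genK i) = mk_K c *\<^sub>R E (genK i) + mk_P c *\<^sub>R E (genP i)"
| "gen_bracket c (genK i) genM = - (mk_K c *\<^sub>R E (genK i) + mk_P c *\<^sub>R E (genP i))"
| "gen_bracket c genM (genP i) = mp_K c *\<^sub>R E (genK i) + mp_P c *\<^sub>R E (genP i)"
| "gen_bracket c (genP i) genM = - (mp_K c *\<^sub>R E (genK i) + mp_P c *\<^sub>R E (genP i))"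
| "gen_bracket c (genK i) (genP j) =
     kdelta i j *\<^sub>R (kp_H c *\<^sub>R E genH + kp_M c *\<^sub>R E genM) + kp_J c *\<^sub>R E (genJ i j)"
| "gen_bracket c (genP j) (genK i) =
     - (kdelta i j *\<^sub>R (kp_H c *\<^sub>R E genH + kp_M c *\<^sub>R E genM) + kp_J c *\<^sub>R E (genJ i j))"
| "gen_bracket c (genK i) (genK j) = kk_J c *\<^sub>R E (genJ i j)"
| "gen_bracket c (genP i) (genP j) = pp_J c *\<^sub>R E (genJ i j)"
| "gen_bracket c (genJ i j) (genP k) = - kdelta i k *\<^sub>R E (genP j) + kdelta j k *\<^sub>R E (genP i)"
| "gen_bracket c (genP k) (genJ i j) =
     - (- kdelta i k *\<^sub>R E (genP j) + kdelta j k *\<^sub>R E (genP i))"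
| "gen_bracket c (genJ i j) (genK k) = - kdelta i k *\<^sub>R E (genK j) + kdelta j k *\<^sub>R E (genK i)"
| "gen_bracket c (genK k) (genJ i j) =
     - (- kdelta i k *\<^sub>R E (genK j) + kdelta j k *\<^sub>R E (genK i))"
| "gen_bracket c (genJ i j) (genJ k l) =
     kdelta j k *\<^sub>R E (genJ i l) - kdelta j l *\<^sub>R E (genJ i k)
     + kdelta i l *\<^sub>R E (genJ j k) - kdelta i k *\<^sub>R E (genJ j l)"
| "gen_bracket c _ _ = 0"

definition vec_bracket :: "coeffs \<Rightarrow> vec \<Rightarrow> vec \<Rightarrow> vec" where
  "vec_bracket c x y =
     (\<Sum>a\<in>Poly_Mapping.keys x. \<Sum>b\<in>Poly_Mapping.keys y.
        (Poly_Mapping.lookup x a * Poly_Mapping.lookup y b) *\<^sub>R gen_bracket c a b)"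

definition model :: "coeffs \<Rightarrow> nat \<Rightarrow> vec triplet" where
  "model c d =
     \<lparr>algebra = span (E ` gens d),
      bracket = vec_bracket c,
      isotropy = span (E ` (Kgens d \<union> Jgens d)),
      ideal_part = span {E genM},
      scalars = span {E genM, E genH},
      vectors = span (E ` (Pgens d \<union> Kgens d)),
      rotations = span (E ` Jgens d)\<rparr>"


subsection \<open>The list of triplets\<close>

definition no_coeffs :: coeffs where
  "no_coeffs =
     \<lparr>hm_H = 0, hm_M = 0, kh_K = 0, kh_P = 0, hp_K = 0, hp_P = 0, mk_K = 0, mk_P = 0,
      mp_K = 0, mp_P = 0, kp_H = 0, kp_M = 0, kp_J = 0, kk_J = 0, pp_J = 0\<rparr>"

definition g_ambient_coeffs :: "real \<Rightarrow> real \<Rightarrow> real \<Rightarrow> coeffs" where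
  "g_ambient_coeffs \<epsilon> \<omega> l = no_coeffs\<lparr>kh_P := 1, hp_K := \<epsilon>, hp_P := \<omega>, hm_M := l\<rparr>"

definition g_ambient_family :: "coeffs set" where
  "g_ambient_family =
     {g_ambient_coeffs 0 0 0, g_ambient_coeffs 0 0 1}
     \<union> {g_ambient_coeffs 0 1 l | l. True}
     \<union> {g_ambient_coeffs 1 0 l | l. l \<ge> 0}
     \<union> {g_ambient_coeffs (-1) 0 l | l. l \<ge> 0}
     \<union> {g_ambient_coeffs 1 \<alpha> l | \<alpha> l. \<alpha> > 0}
     \<union> {g_ambient_coeffs (-1) \<alpha> l | \<alpha> l. \<alpha> > 0}"

definition bargmann_coeffs :: "real \<Rightarrow> real \<Rightarrow> coeffs" where
  "bargmann_coeffs \<epsilon> \<omega> = no_coeffs\<lparr>kp_M := 1, kh_P := 1, hp_K := \<epsilon>, hp_P := \<omega>, hm_M := \<omega>\<rparr>"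

definition bargmann_family :: "coeffs set" where
  "bargmann_family =
     {bargmann_coeffs 0 0, bargmann_coeffs 0 1, bargmann_coeffs 1 0, bargmann_coeffs (-1) 0}
     \<union> {bargmann_coeffs 1 \<alpha> | \<alpha>. \<alpha> > 0}
     \<union> {bargmann_coeffs (-1) \<alpha> | \<alpha>. \<alpha> > 0}"

definition carroll_family :: "coeffs set" where
  "carroll_family =
     {no_coeffs\<lparr>kp_H := 1\<rparr>,
      no_coeffs\<lparr>kp_H := 1, hp_K := -1, pp_J := -1\<rparr>,
      no_coeffs\<lparr>kp_H := 1, hp_K := 1, pp_J := 1\<rparr>,
      no_coeffs\<lparr>kp_H := 1, kp_J := 1, hp_P := -1, kh_K := -1\<rparr>}"

definition riemann_family :: "coeffs set" where
  "riemann_family =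
     {no_coeffs\<lparr>kk_J := -1, kp_H := 1, kh_P := -1, hp_K := \<eta>, pp_J := \<eta>\<rparr> | \<eta>. \<eta> \<in> {0, -1, 1}}"

definition lorentz_family :: "coeffs set" where
  "lorentz_family =
     {no_coeffs\<lparr>kk_J := 1, kp_H := 1, kh_P := 1, hp_K := \<eta>, pp_J := \<eta>\<rparr> | \<eta>. \<eta> \<in> {0, -1, 1}}"

definition triplet_list :: "coeffs set" where
  "triplet_list =
     g_ambient_family \<union> bargmann_family \<union> carroll_family \<union> riemann_family \<union> lorentz_family"


subsection \<open>Invariant structures on \<open>g/h\<close>\<close>

definition homogeneous_space :: "'a::real_vector triplet \<Rightarrow> 'a set space" where
  "homogeneous_space T = quotient_space (algebra T) (isotropy T)"

definition isotropy_action :: "'a::real_vector triplet \<Rightarrow> 'a \<Rightarrow> 'a set \<Rightarrow> 'a set" where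
  "isotropy_action T x A = (\<Union>a\<in>A. coset (isotropy T) (bracket T x a))"

definition linear_form :: "'v space \<Rightarrow> ('v \<Rightarrow> real) \<Rightarrow> bool" where
  "linear_form V \<psi> \<longleftrightarrow>
     (\<forall>v\<in>points V. \<forall>w\<in>points V. \<psi> (plus_of V v w) = \<psi> v + \<psi> w) \<and>
     (\<forall>r. \<forall>v\<in>points V. \<psi> (scale_of V r v) = r * \<psi> v)"

definition sym_bilinear_form_on :: "'v space \<Rightarrow> 'v set \<Rightarrow> ('v \<Rightarrow> 'v \<Rightarrow> real) \<Rightarrow> bool" where
  "sym_bilinear_form_on V W \<gamma> \<longleftrightarrow>
     (\<forall>v\<in>W. \<forall>w\<in>W. \<gamma> v w = \<gamma> w v) \<and>
     (\<forall>u\<in>W. \<forall>v\<in>W. \<forall>w\<in>W. \<gamma> (plus_of V u v) w = \<gamma> u w + \<gamma> v w) \<and>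
     (\<forall>r. \<forall>v\<in>W. \<forall>w\<in>W. \<gamma> (scale_of V r v) w = r * \<gamma> v w)"

text \<open>Invariance means that the induced infinitesimal action of \<open>h\<close> annihilates the tensor. On a
  form it is \<open>(x \<cdot> \<psi>) v = - \<psi> (x \<cdot> v)\<close>, on a bilinear form
  \<open>(x \<cdot> \<gamma>) (v, w) = - \<gamma> (x \<cdot> v, w) - \<gamma> (v, x \<cdot> w)\<close>.\<close>

definition invariant_vector :: "'a::real_vector triplet \<Rightarrow> 'a set \<Rightarrow> bool" where
  "invariant_vector T \<xi> \<longleftrightarrow>
     \<xi> \<in> points (homogeneous_space T) \<and>
     (\<forall>x\<in>isotropy T. isotropy_action T x \<xi> = origin (homogeneous_space T))"

definition invariant_form :: "'a::real_vector triplet \<Rightarrow> ('a set \<Rightarrow> real) \<Rightarrow> bool" where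
  "invariant_form T \<psi> \<longleftrightarrow>
     linear_form (homogeneous_space T) \<psi> \<and>
     (\<forall>x\<in>isotropy T. \<forall>v\<in>points (homogeneous_space T). - \<psi> (isotropy_action T x v) = 0)"

definition invariant_sym_form_on ::
  "'a::real_vector triplet \<Rightarrow> 'a set set \<Rightarrow> ('a set \<Rightarrow> 'a set \<Rightarrow> real) \<Rightarrow> bool" where
  "invariant_sym_form_on T W \<gamma> \<longleftrightarrow>
     sym_bilinear_form_on (homogeneous_space T) W \<gamma> \<and>
     (\<forall>x\<in>isotropy T. \<forall>v\<in>W. \<forall>w\<in>W.
        - \<gamma> (isotropy_action T x v) w - \<gamma> v (isotropy_action T x w) = 0)"

definition invariant_sym_form ::
  "'a::real_vector triplet \<Rightarrow> ('a set \<Rightarrow> 'a set \<Rightarrow> real) \<Rightarrow> bool" where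
  "invariant_sym_form T \<gamma> \<longleftrightarrow> invariant_sym_form_on T (points (homogeneous_space T)) \<gamma>"

definition form_kernel :: "'v space \<Rightarrow> ('v \<Rightarrow> real) \<Rightarrow> 'v set" where
  "form_kernel V \<psi> = {v \<in> points V. \<psi> v = 0}"

definition leibnizian ::
  "'a::real_vector triplet \<Rightarrow> 'a set \<Rightarrow> ('a set \<Rightarrow> real) \<Rightarrow> ('a set \<Rightarrow> 'a set \<Rightarrow> real) \<Rightarrow> bool" where
  "leibnizian T \<xi> \<psi> \<gamma> \<longleftrightarrow>
     (let V = homogeneous_space T; W = form_kernel V \<psi> in
       invariant_vector T \<xi> \<and> \<xi> \<noteq> origin V \<and>
       invariant_form T \<psi> \<and> (\<exists>v\<in>points V. \<psi> v \<noteq> 0) \<and> \<psi> \<xi> = 0 \<and>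
       invariant_sym_form_on T W \<gamma> \<and> (\<forall>v\<in>W. \<gamma> v v \<ge> 0) \<and>
       {v \<in> W. \<forall>w\<in>W. \<gamma> v w = 0} = {scale_of V r \<xi> | r. True})"

definition g_ambient ::
  "'a::real_vector triplet \<Rightarrow> 'a set \<Rightarrow> ('a set \<Rightarrow> real) \<Rightarrow> ('a set \<Rightarrow> 'a set \<Rightarrow> real)
   \<Rightarrow> ('a set \<Rightarrow> real) \<Rightarrow> bool" where
  "g_ambient T \<xi> \<psi> \<gamma> A \<longleftrightarrow> leibnizian T \<xi> \<psi> \<gamma> \<and> invariant_form T A \<and> A \<xi> = 1"

definition bargmannian ::
  "'a::real_vector triplet \<Rightarrow> 'a set \<Rightarrow> ('a set \<Rightarrow> real) \<Rightarrow> ('a set \<Rightarrow> 'a set \<Rightarrow> real)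
   \<Rightarrow> ('a set \<Rightarrow> 'a set \<Rightarrow> real) \<Rightarrow> bool" where
  "bargmannian T \<xi> \<psi> \<gamma> g \<longleftrightarrow>
     (let V = homogeneous_space T; W = form_kernel V \<psi> in
       leibnizian T \<xi> \<psi> \<gamma> \<and> invariant_sym_form T g \<and>
       (\<forall>v\<in>points V. g \<xi> v = \<psi> v) \<and> (\<forall>v\<in>W. \<forall>w\<in>W. g v w = \<gamma> v w))"

text \<open>For the models, an element of \<open>g/h\<close> is identified with its unique representative in
  \<open>Span {M, H, P\<^sub>i}\<close>; \<open>M_dual\<close>, \<open>H_dual\<close> and \<open>P_dual\<close> form the corresponding dual basis. The
  space \<open>h\<close> of \<open>model c d\<close> depends on \<open>d\<close> only.\<close>

definition quotient_vec :: "nat \<Rightarrow> gen \<Rightarrow> vec set" where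
  "quotient_vec d a = coset (span (E ` (Kgens d \<union> Jgens d))) (E a)"

definition representative :: "nat \<Rightarrow> vec set \<Rightarrow> vec" where
  "representative d A = (THE v. v \<in> A \<and> v \<in> span (E ` ({genM, genH} \<union> Pgens d)))"

definition M_dual :: "nat \<Rightarrow> vec set \<Rightarrow> real" where
  "M_dual d A = Poly_Mapping.lookup (representative d A) genM"

definition H_dual :: "nat \<Rightarrow> vec set \<Rightarrow> real" where
  "H_dual d A = Poly_Mapping.lookup (representative d A) genH"

definition P_dual :: "nat \<Rightarrow> nat \<Rightarrow> vec set \<Rightarrow> real" where
  "P_dual d i A = Poly_Mapping.lookup (representative d A) (genP i)"

definition PP_dual :: "nat \<Rightarrow> vec set \<Rightarrow> vec set \<Rightarrow> real" where
  "PP_dual d A B = (\<Sum>i=1..d. P_dual d i A * P_dual d i B)"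

end

theory Submission
  imports Defs
begin

text \<open>The Jacobi identities with one or two different indices, the ideal spanned by \<open>M\<close> and
  effectivity force a few polynomial relations on the coefficients (\<open>admissible\<close>): up to
  \<open>[K, H] = k K + p P\<close>, \<open>[H, P] = q K + r P\<close>, \<open>[K, P] = a H + b M + c J\<close>, \<open>[H, M] = \<lambda> M\<close> everything
  vanishes or is determined (\<open>c = - a k\<close>, \<open>[K, K] = a p J\<close>, \<open>[P, P] = a q J\<close>), where
  \<open>a \<lambda> = 0\<close>, \<open>a (r - k) = 0\<close>, \<open>b (\<lambda> - r + k) = 0\<close> and \<open>a \<noteq> 0\<close> or \<open>p \<noteq> 0\<close>. Conversely, these relations
  suffice, as the Jacobi identity on generators is then a formal consequence of the symmetry of
  \<open>\<delta>\<^sub>i\<^sub>j\<close> and the antisymmetry of \<open>J\<^sub>i\<^sub>j\<close>.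

  If \<open>a = 0\<close>, replacing \<open>P\<close> by \<open>k K + p P\<close> and rescaling \<open>H\<close> gives the first two families. If \<open>a \<noteq> 0\<close>, replacing
  \<open>H\<close> by \<open>a H + b M\<close> makes \<open>M\<close> a direct summand, and adding a multiple of \<open>K\<close> to \<open>P\<close> and rescaling
  gives the others. That the normal forms are pairwise non-isomorphic is already visible
  for \<open>d = 1\<close>, where an isomorphism is a triangular change of the basis \<open>M, H, P, K\<close>.\<close>

subsection \<open>The bracket of the models\<close>

text \<open>A scalar multiple is defined by abstracting a function, so its values are available only
  once the support is known to be finite.\<close>

lemma lookup_scaleR [simp]:
  "Poly_Mapping.lookup (r *\<^sub>R x) a = r *\<^sub>R Poly_Mapping.lookup x a"
proof -
  have "{i. r *\<^sub>R Poly_Mapping.lookup x i \<noteq> 0} \<subseteq> Poly_Mapping.keys x"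
    by (auto simp: in_keys_iff)
  then have "finite {i. r *\<^sub>R Poly_Mapping.lookup x i \<noteq> 0}"
    using finite_keys finite_subset by blast
  then show ?thesis
    by (simp add: scaleR_poly_mapping_def)
qed

text \<open>The supports of \<open>x\<close>, \<open>y\<close> and \<open>x + y\<close> differ;
  summing over one common finite set adds only zero terms and makes the bracket visibly linear in
  the coordinates.\<close>

lemma vec_bracket_superset:
  assumes "finite A" "finite B" "Poly_Mapping.keys x \<subseteq> A" "Poly_Mapping.keys y \<subseteq> B"
  shows "vec_bracket c x y =
    (\<Sum>a\<in>A. \<Sum>b\<in>B. (Poly_Mapping.lookup x a * Poly_Mapping.lookup y b) *\<^sub>R gen_bracket c a b)"
proof -
  have "vec_bracket c x y = (\<Sum>a\<in>A. \<Sum>b\<in>Poly_Mapping.keys y.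
      (Poly_Mapping.lookup x a * Poly_Mapping.lookup y b) *\<^sub>R gen_bracket c a b)"
    unfolding vec_bracket_def using assms
    by (intro sum.mono_neutral_left) (auto simp: in_keys_iff)
  also have "\<dots> = (\<Sum>a\<in>A. \<Sum>b\<in>B.
      (Poly_Mapping.lookup x a * Poly_Mapping.lookup y b) *\<^sub>R gen_bracket c a b)"
    using assms by (intro sum.cong sum.mono_neutral_left) (auto simp: in_keys_iff)
  finally show ?thesis .
qed

lemma vec_bracket_add_left: "vec_bracket c (x + y) z = vec_bracket c x z + vec_bracket c y z"
proof -
  let ?A = "Poly_Mapping.keys x \<union> Poly_Mapping.keys y"
  have "vec_bracket c w z = (\<Sum>a\<in>?A. \<Sum>b\<in>Poly_Mapping.keys z.
      (Poly_Mapping.lookup w a * Poly_Mapping.lookup z b) *\<^sub>R gen_bracket c a b)"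
    if "Poly_Mapping.keys w \<subseteq> ?A" for w
    using that by (intro vec_bracket_superset) auto
  then show ?thesis
    using Poly_Mapping.keys_add[of x y]
    by (simp add: lookup_add ring_distribs scaleR_left.add sum.distrib)
qed

lemma vec_bracket_scaleR_left: "vec_bracket c (r *\<^sub>R x) z = r *\<^sub>R vec_bracket c x z"
proof -
  have "Poly_Mapping.keys (r *\<^sub>R x) \<subseteq> Poly_Mapping.keys x"
    by (auto simp: in_keys_iff)
  then have "vec_bracket c (r *\<^sub>R x) z = (\<Sum>a\<in>Poly_Mapping.keys x. \<Sum>b\<in>Poly_Mapping.keys z.
      (Poly_Mapping.lookup (r *\<^sub>R x) a * Poly_Mapping.lookup z b) *\<^sub>R gen_bracket c a b)"
    by (intro vec_bracket_superset) auto
  then show ?thesis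
    by (simp add: vec_bracket_def scaleR_sum_right mult.assoc)
qed

text \<open>An antisymmetrised form without a case split on the order of \<open>i\<close> and
  \<open>j\<close>; the Jacobi identities are checked on it.\<close>

lemma E_genJ:
  "E (genJ i j) = (if i < j then Poly_Mapping.single (genJ i j) 1 else 0)
     - (if j < i then Poly_Mapping.single (genJ j i) 1 else 0)"
  by simp

declare E.simps(1) [simp del]

lemma E_genJ_swap: "E (genJ j i) = - E (genJ i j)"
  by (simp add: E.simps(1))

lemma gen_bracket_antisym: "gen_bracket c b a = - gen_bracket c a b"
proof (cases a; cases b)
  fix i j k l assume "a = genJ i j" "b = genJ k l"
  then show ?thesis
    using E_genJ_swap[of i l] E_genJ_swap[of i k] E_genJ_swap[of j l] E_genJ_swap[of j k]
    by (simp add: eq_commute[of k] eq_commute[of l])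
next
  fix i j assume "a = genP i" "b = genP j"
  then show ?thesis
    using E_genJ_swap[of i j] by simp
next
  fix i j assume "a = genK i" "b = genK j"
  then show ?thesis
    using E_genJ_swap[of i j] by simp
qed simp_all

lemma vec_bracket_antisym: "vec_bracket c y x = - vec_bracket c x y"
proof -
  have "vec_bracket c y x = (\<Sum>b\<in>Poly_Mapping.keys x. \<Sum>a\<in>Poly_Mapping.keys y.
      (Poly_Mapping.lookup y a * Poly_Mapping.lookup x b) *\<^sub>R gen_bracket c a b)"
    unfolding vec_bracket_def by (rule sum.swap)
  also have "\<dots> = - vec_bracket c x y"
    unfolding vec_bracket_def sum_negf[symmetric]
    by (intro sum.cong refl) (subst gen_bracket_antisym, simp add: mult.commute)
  finally show ?thesis .
qed

lemma bilinear_vec_bracket: "bilinear (vec_bracket c)"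
proof -
  have l: "linear (\<lambda>x. vec_bracket c x y)" for y
    by (intro linearI vec_bracket_add_left vec_bracket_scaleR_left)
  moreover have "linear (vec_bracket c x)" for x
    using linear_compose_neg[OF l[of x]] vec_bracket_antisym[of c _ x]
    by (simp add: fun_eq_iff)
  ultimately show ?thesis
    by (simp add: bilinear_def)
qed

lemmas vec_bracket_bilinear_simps =
  bilinear_ladd[OF bilinear_vec_bracket] bilinear_radd[OF bilinear_vec_bracket]
  bilinear_lsub[OF bilinear_vec_bracket] bilinear_rsub[OF bilinear_vec_bracket]
  bilinear_lneg[OF bilinear_vec_bracket] bilinear_rneg[OF bilinear_vec_bracket]
  bilinear_lmul[OF bilinear_vec_bracket] bilinear_rmul[OF bilinear_vec_bracket]
  bilinear_lzero[OF bilinear_vec_bracket] bilinear_rzero[OF bilinear_vec_bracket]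

lemma vec_bracket_single:
  "vec_bracket c (Poly_Mapping.single a 1) (Poly_Mapping.single b 1) = gen_bracket c a b"
  by (simp add: vec_bracket_def)

lemma E_genJ_refl: "E (genJ i i) = 0"
  by (simp add: E.simps(1))

lemma gen_bracket_genJ_swap: "gen_bracket c (genJ j i) b = - gen_bracket c (genJ i j) b"
  by (cases b) (auto simp: algebra_simps)

text \<open>The generators \<open>genJ i j\<close> with \<open>j \<le> i\<close> are redundant:
  \<open>E\<close> sends them to zero or to minus a basis vector, and \<open>gen_bracket\<close>
  behaves accordingly. Hence \<open>vec_bracket\<close>, a sum over basis vectors, can be evaluated
  by \<open>gen_bracket\<close> on every generator.\<close>

lemma E_cases:
  obtains "E a = Poly_Mapping.single a 1"
  | "E a = 0" "\<And>c b. gen_bracket c a b = 0"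
  | i j where "a = genJ j i" "E a = - Poly_Mapping.single (genJ i j) 1"
proof (cases a)
  case (genJ i j)
  have "gen_bracket c (genJ i i) b = 0" for c b
    using gen_bracket_genJ_swap[of c i i b] by (simp add: eq_neg_iff_add_eq_0 scaleR_2[symmetric])
  with genJ show ?thesis
    by (cases i j rule: linorder_cases) (use that in \<open>auto simp: E.simps(1)\<close>)
qed (use that in auto)

lemma vec_bracket_E: "vec_bracket c (E a) (E b) = gen_bracket c a b"
proof -
  have *: "vec_bracket c (E a) (Poly_Mapping.single b 1) = gen_bracket c a b" for a b
  proof (cases a rule: E_cases)
    case (3 i j)
    then show ?thesis
      using gen_bracket_genJ_swap[of c j i b]
      by (simp add: vec_bracket_bilinear_simps vec_bracket_single)
  qed (simp_all add: vec_bracket_bilinear_simps vec_bracket_single)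
  \<comment> \<open>The reversed order on the right lets the vanishing clause of
    \<open>E_cases\<close>, which concerns the first slot, be applied to \<open>b\<close>.\<close>
  have "vec_bracket c (E a) (E b) = - gen_bracket c b a"
  proof (cases b rule: E_cases)
    case (3 i j)
    then show ?thesis
      using * [of a "genJ i j"] gen_bracket_genJ_swap[of c j i a]
        gen_bracket_antisym[of c a "genJ i j"]
      by (simp add: vec_bracket_bilinear_simps)
  next
    case 1
    then show ?thesis
      using * [of a b] gen_bracket_antisym[of c a b] by simp
  qed (simp add: vec_bracket_bilinear_simps)
  then show ?thesis
    using gen_bracket_antisym[of c a b] by simp
qed

declare E.simps [simp del]

subsection \<open>The Jacobi identity\<close>

definition admissible :: "coeffs \<Rightarrow> bool" where
  "admissible c \<longleftrightarrow>
     hm_H c = 0 \<and> mk_K c = 0 \<and> mk_P c = 0 \<and> mp_K c = 0 \<and> mp_P c = 0 \<and>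
     kk_J c = kp_H c * kh_P c \<and> kp_J c = - kp_H c * kh_K c \<and> pp_J c = kp_H c * hp_K c \<and>
     kp_H c * hm_M c = 0 \<and> kp_H c * (hp_P c - kh_K c) = 0 \<and>
     kp_M c * (hm_M c - hp_P c + kh_K c) = 0 \<and> (kp_H c \<noteq> 0 \<or> kh_P c \<noteq> 0)"

definition jacobiator :: "coeffs \<Rightarrow> vec \<Rightarrow> vec \<Rightarrow> vec \<Rightarrow> vec" where
  "jacobiator c x y z = vec_bracket c x (vec_bracket c y z) + vec_bracket c y (vec_bracket c z x)
     + vec_bracket c z (vec_bracket c x y)"

lemma jacobiator_rotate: "jacobiator c y z x = jacobiator c x y z"
  by (simp add: jacobiator_def algebra_simps)

lemma jacobiator_swap: "jacobiator c y x z = - jacobiator c x y z"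
  using vec_bracket_antisym[of c x z] vec_bracket_antisym[of c z y] vec_bracket_antisym[of c y x]
  by (simp add: jacobiator_def vec_bracket_bilinear_simps)

text \<open>An ordering that reduces the Jacobi identity to sorted triples. Rotations come last, so
  a rotation in the middle of a sorted triple means that the last entry is one as well.\<close>

fun gen_rank :: "gen \<Rightarrow> nat" where
  "gen_rank genM = 0" | "gen_rank genH = 1" | "gen_rank (genK _) = 2" | "gen_rank (genP _) = 3"
| "gen_rank (genJ _ _) = 4"

text \<open>With two rotations the identity says that scalars, vectors and rotations are
  representations of the rotation algebra; the coefficients in \<open>c\<close> do not
  enter.\<close>

lemma jacobiator_genJ_genJ:
  "jacobiator c (E x) (E (genJ i j)) (E (genJ k l)) = 0"
proof -
  obtain S where S: "E (genJ i j) = S i j - S j i" for i j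
    by (rule that[of "\<lambda>i j. if i < j then Poly_Mapping.single (genJ i j) 1 else 0"]) (rule E_genJ)
  \<comment> \<open>\<open>D\<close> hides the Kronecker delta. Only its symmetry is used
    afterwards, so the indices need no case split and each coordinate is a polynomial
    identity.\<close>
  define D :: "nat \<Rightarrow> nat \<Rightarrow> real" where "D i j = of_bool (i = j)" for i j
  have D: "of_bool (i = j) = D i j" "D i j = D j i" for i j
    by (auto simp: D_def)
  show ?thesis
    by (cases x; hypsubst_thin; simp add: jacobiator_def vec_bracket_E vec_bracket_bilinear_simps D(1);
      rule poly_mapping_eqI; simp add: S D(2) lookup_add lookup_minus; algebra)
qed

lemma sorted_rank_jacobiator:
  assumes adm: "admissible c" and le: "gen_rank x \<le> gen_rank y" "gen_rank y \<le> gen_rank z" "gen_rank y \<noteq> 4"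
  shows "jacobiator c (E x) (E y) (E z) = 0"
proof -
  obtain S where S: "E (genJ i j) = S i j - S j i" for i j
    by (rule that[of "\<lambda>i j. if i < j then Poly_Mapping.single (genJ i j) 1 else 0"]) (rule E_genJ)
  define D :: "nat \<Rightarrow> nat \<Rightarrow> real" where "D i j = of_bool (i = j)" for i j
  have D: "of_bool (i = j) = D i j" "D i j = D j i" for i j
    by (auto simp: D_def)
  have c1: "hm_H c = 0" "mk_K c = 0" "mk_P c = 0" "mp_K c = 0" "mp_P c = 0"
    "kk_J c = kp_H c * kh_P c" "kp_J c = - kp_H c * kh_K c" "pp_J c = kp_H c * hp_K c"
    using adm by (auto simp: admissible_def)
  \<comment> \<open>The product relations are resolved into three alternatives, in each of which
    coefficients vanish or are expressed by others.\<close>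
  consider "kp_H c = 0" "kp_M c = 0" | "kp_H c = 0" "hm_M c = hp_P c - kh_K c"
    | "hm_M c = 0" "hp_P c = kh_K c"
    using adm by (auto simp: admissible_def)
  then show ?thesis
    by cases
     (insert le; cases x; cases y; cases z; hypsubst_thin;
      simp add: jacobiator_def vec_bracket_E vec_bracket_bilinear_simps c1 D(1);
      simp add: S algebra_simps D(2))+
qed

text \<open>Cyclic shifts and swaps of the arguments change the jacobiator at most by a sign, so
  every triple may be sorted by rank.\<close>

lemma jacobiator_E:
  assumes "admissible c"
  shows "jacobiator c (E x) (E y) (E z) = 0"
proof -
  have sorted: "jacobiator c (E x) (E y) (E z) = 0" if "gen_rank x \<le> gen_rank y" "gen_rank y \<le> gen_rank z" for x y z
    using that jacobiator_genJ_genJ sorted_rank_jacobiator[OF assms that]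
    by (cases y; cases z) auto
  consider "gen_rank x \<le> gen_rank y" "gen_rank y \<le> gen_rank z" | "gen_rank x \<le> gen_rank z" "gen_rank z \<le> gen_rank y"
    | "gen_rank y \<le> gen_rank x" "gen_rank x \<le> gen_rank z" | "gen_rank y \<le> gen_rank z" "gen_rank z \<le> gen_rank x"
    | "gen_rank z \<le> gen_rank x" "gen_rank x \<le> gen_rank y" | "gen_rank z \<le> gen_rank y" "gen_rank y \<le> gen_rank x"
    by linarith
  then show ?thesis
    using sorted jacobiator_rotate jacobiator_swap
    by cases (metis neg_equal_0_iff_equal)+
qed

text \<open>Linearity in the first argument is enough: cyclic shifts bring each argument to the
  front in turn.\<close>

lemma jacobiator_span:
  assumes "admissible c" "x \<in> span (range E)" "y \<in> span (range E)" "z \<in> span (range E)"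
  shows "jacobiator c x y z = 0"
proof -
  have left: "jacobiator c x y z = 0"
    if x: "x \<in> span (range E)" and E: "\<And>a. jacobiator c (E a) y z = 0" for x y z
    using x
  proof (induction rule: span_induct_alt)
    case (step r v w)
    then show ?case
      using E by (auto simp: jacobiator_def vec_bracket_bilinear_simps algebra_simps
          simp flip: scaleR_add_right)
  qed (simp add: jacobiator_def vec_bracket_bilinear_simps)
  have "jacobiator c (E a) y z = 0" for a
    by (metis left assms jacobiator_E jacobiator_rotate)
  then show ?thesis
    using left assms by blast
qed

subsection \<open>Cosets and the Lie algebra of a model\<close>

lemma mem_coset_iff: "y \<in> coset s x \<longleftrightarrow> y - x \<in> s"
  unfolding coset_def by (auto simp: algebra_simps intro: exI[of _ "y - x"])

lemma coset_eq_iff: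
  assumes "subspace s"
  shows "coset s x = coset s y \<longleftrightarrow> x - y \<in> s"
proof
  assume "coset s x = coset s y"
  moreover have "x \<in> coset s x"
    using assms by (simp add: mem_coset_iff subspace_0)
  ultimately show "x - y \<in> s"
    by (simp add: mem_coset_iff)
next
  assume *: "x - y \<in> s"
  have "z - x \<in> s \<longleftrightarrow> z - y \<in> s" for z
    using subspace_add[OF assms *, of "z - x"] subspace_diff[OF assms _ *, of "z - y"] by auto
  then show "coset s x = coset s y"
    by (auto simp: mem_coset_iff)
qed

lemma coset_zero: "coset s 0 = s"
  by (auto simp: mem_coset_iff)

lemma coset_plus:
  assumes "subspace s"
  shows "{a + b | a b. a \<in> coset s x \<and> b \<in> coset s y} = coset s (x + y)" (is "?L = _")
proof
  show "?L \<subseteq> coset s (x + y)"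
    using subspace_add[OF assms] by (fastforce simp: mem_coset_iff add_diff_add)
  show "coset s (x + y) \<subseteq> ?L"
  proof
    fix z assume "z \<in> coset s (x + y)"
    then have "z = x + (z - x)" "x \<in> coset s x" "z - x \<in> coset s y"
      using assms by (auto simp: mem_coset_iff subspace_0 algebra_simps)
    then show "z \<in> ?L" by blast
  qed
qed

text \<open>Operations on a quotient are written as unions over all representatives; when the
  operation is well defined, all members of the union are the same coset.\<close>

lemma Union_coset:
  assumes "subspace s" "\<And>a. a \<in> coset s x \<Longrightarrow> f a - f x \<in> s"
  shows "(\<Union>a\<in>coset s x. coset s (f a)) = coset s (f x)"
proof -
  have "coset s (f a) = coset s (f x)" if "a \<in> coset s x" for a
    using assms that by (simp add: coset_eq_iff)
  moreover have "x \<in> coset s x"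
    using assms by (simp add: mem_coset_iff subspace_0)
  ultimately show ?thesis by blast
qed

lemma coset_scale:
  assumes "subspace s"
  shows "(\<Union>a\<in>coset s x. coset s (r *\<^sub>R a)) = coset s (r *\<^sub>R x)"
  using subspace_scale[OF assms]
  by (intro Union_coset assms) (auto simp: mem_coset_iff simp flip: scaleR_diff_right)

text \<open>\<open>s\<close> absorbs brackets in the second slot by assumption; antisymmetry,
  obtained by polarising \<open>br w w = 0\<close>, gives the same in the first slot. The
  representatives are then varied one slot at a time.\<close>

lemma coset_bracket:
  assumes L: "lie_algebra g br" and s: "subspace s" "s \<subseteq> g" "\<And>x y. x \<in> g \<Longrightarrow> y \<in> s \<Longrightarrow> br x y \<in> s"
    and xy: "x \<in> g" "y \<in> g"
  shows "(\<Union>a\<in>coset s x. \<Union>b\<in>coset s y. coset s (br a b)) = coset s (br x y)"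
proof -
  have add: "br (u + v) w = br u w + br v w" "br w (u + v) = br w u + br w v"
    if "u \<in> g" "v \<in> g" "w \<in> g" for u v w
    using L that unfolding lie_algebra_def by blast+
  have g: "subspace g"
    using L unfolding lie_algebra_def by blast
  have swap: "br u v + br v u = 0" if "u \<in> g" "v \<in> g" for u v
  proof -
    have "br w w = 0" if "w \<in> g" for w
      using L that unfolding lie_algebra_def by blast
    then have "br (u + v) (u + v) = 0" "br u u = 0" "br v v = 0"
      using that subspace_add[OF g] by auto
    then show ?thesis
      using that by (simp add: add subspace_add[OF g] add.commute)
  qed
  have right: "br u b - br u v \<in> s" if "u \<in> g" "v \<in> g" "b \<in> coset s v" for u v b
  proof -
    have "br u (v + (b - v)) = br u v + br u (b - v)"
      using that s(2) by (intro add) (auto simp: mem_coset_iff)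
    then show ?thesis
      using that s(3) by (simp add: mem_coset_iff)
  qed
  have left: "br a v - br u v \<in> s" if "u \<in> g" "v \<in> g" "a \<in> coset s u" for u v a
  proof -
    have "a \<in> g"
      using that s(2) subspace_add[OF g, of u "a - u"] by (auto simp: mem_coset_iff)
    then have "br a v = - br v a" "br u v = - br v u"
      using swap that by (auto simp: eq_neg_iff_add_eq_0)
    then have "br a v - br u v = - (br v a - br v u)"
      by simp
    then show ?thesis
      using right[OF that(2,1,3)] subspace_neg[OF s(1), of "br v a - br v u"] by simp
  qed
  have "(\<Union>b\<in>coset s y. coset s (br a b)) = coset s (br a y)" if "a \<in> coset s x" for a
  proof -
    have "a \<in> g"
      using that xy s(2) subspace_add[OF g, of x "a - x"] by (auto simp: mem_coset_iff)
    then show ?thesis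
      using right xy by (intro Union_coset s)
  qed
  then have "(\<Union>a\<in>coset s x. \<Union>b\<in>coset s y. coset s (br a b)) = (\<Union>a\<in>coset s x. coset s (br a y))"
    by simp
  also have "\<dots> = coset s (br x y)"
    using left xy by (intro Union_coset s)
  finally show ?thesis .
qed

lemma quotient_lie_simps [simp]:
  "points (quotient_lie g br s) = coset s ` g"
  "origin (quotient_lie g br s) = s"
  "plus_of (quotient_lie g br s) = (\<lambda>A B. {a + b | a b. a \<in> A \<and> b \<in> B})"
  "scale_of (quotient_lie g br s) = (\<lambda>r A. \<Union>a\<in>A. coset s (r *\<^sub>R a))"
  "bracket_of (quotient_lie g br s) = (\<lambda>A B. \<Union>a\<in>A. \<Union>b\<in>B. coset s (br a b))"
  by (simp_all add: quotient_lie_def quotient_space_def space.extend_def lie_space.fields_def)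

section \<open>Generators as a basis of the model\<close>

lemma E_gens: "a \<in> gens d \<Longrightarrow> E a = Poly_Mapping.single a 1"
  by (auto simp: gens_def E.simps)

lemma finite_gens: "finite (gens d)"
proof -
  have "Jgens d \<subseteq> (\<lambda>(i, j). genJ i j) ` ({1..d} \<times> {1..d})"
    by auto
  then have "finite (Jgens d)"
    by (rule finite_subset) simp
  then show ?thesis
    unfolding gens_def by simp
qed

text \<open>On \<open>gens d\<close> the values of \<open>E\<close> are distinct unit vectors, so
  lying in a span is a condition on supports. Algebra, isotropy and ideal are all handled through
  this.\<close>

lemma mem_span_E_iff:
  assumes "S \<subseteq> gens d"
  shows "x \<in> span (E ` S) \<longleftrightarrow> Poly_Mapping.keys x \<subseteq> S"
proof
  assume "x \<in> span (E ` S)"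
  then have "Poly_Mapping.lookup x a = 0" if "a \<notin> S" for a
  proof (induction rule: span_induct_alt)
    case (step r v w)
    then obtain b where "b \<in> S" "v = E b"
      by blast
    with step that show ?case
      using assms E_gens[of b d] by (auto simp: lookup_add lookup_single)
  qed simp
  then show "Poly_Mapping.keys x \<subseteq> S"
    by (auto simp: in_keys_iff)
next
  assume x: "Poly_Mapping.keys x \<subseteq> S"
  have "x = (\<Sum>a\<in>Poly_Mapping.keys x. Poly_Mapping.lookup x a *\<^sub>R E a)"
  proof (rule poly_mapping_eqI)
    fix b
    have "(\<Sum>a\<in>Poly_Mapping.keys x. Poly_Mapping.lookup x a * Poly_Mapping.lookup (E a) b)
      = (\<Sum>a\<in>Poly_Mapping.keys x. if a = b then Poly_Mapping.lookup x a else 0)"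
      using x assms E_gens[of _ d] by (intro sum.cong) (auto simp: lookup_single when_def)
    then show "Poly_Mapping.lookup x b = Poly_Mapping.lookup
        (\<Sum>a\<in>Poly_Mapping.keys x. Poly_Mapping.lookup x a *\<^sub>R E a) b"
      by (simp add: lookup_sum in_keys_iff)
  qed
  also have "\<dots> \<in> span (E ` S)"
    using x by (intro span_sum span_scale span_base) auto
  finally show "x \<in> span (E ` S)" .
qed

lemma frame_E: "frame d (span (E ` gens d)) E"
proof -
  have inj: "inj_on E (gens d)"
    by (auto simp: inj_on_def E_gens dest: arg_cong[where f = Poly_Mapping.keys])
  \<comment> \<open>A vector in the span of the other generators does not have \<open>a\<close> in
    its support.\<close>
  have "E a \<notin> span (E ` gens d - {E a})" if "a \<in> gens d" for a
  proof -
    have "E ` gens d - {E a} = E ` (gens d - {a})"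
      using inj that by (auto simp: inj_on_def)
    then show ?thesis
      using that mem_span_E_iff[of "gens d - {a}" d "E a"] by (auto simp: E_gens)
  qed
  then have "independent (E ` gens d)"
    unfolding dependent_def by blast
  then show ?thesis
    unfolding frame_def by (intro conjI inj ballI E_genJ_swap refl)
qed

text \<open>Reduces closure of the algebra, the isotropy and the ideal under brackets to a check on
  generators.\<close>

lemma vec_bracket_mem_subspace:
  assumes "x \<in> span (E ` S)" "y \<in> span (E ` T)" "subspace V"
    and "\<And>a b. a \<in> S \<Longrightarrow> b \<in> T \<Longrightarrow> gen_bracket c a b \<in> V"
  shows "vec_bracket c x y \<in> V"
proof -
  have E: "vec_bracket c (E a) y \<in> V" if "a \<in> S" for a
    using assms(2)
    by (induction rule: span_induct_alt)
      (use assms that in \<open>auto simp: vec_bracket_bilinear_simps vec_bracket_E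
         intro!: subspace_0 subspace_add subspace_scale\<close>)
  show ?thesis
    using assms(1)
    by (induction rule: span_induct_alt)
      (use assms(3) E in \<open>auto simp: vec_bracket_bilinear_simps
         intro!: subspace_0 subspace_add subspace_scale\<close>)
qed

text \<open>Brackets produce \<open>genJ i j\<close> with indices in any order, whereas only those
  with \<open>i < j\<close> belong to the spanning sets.\<close>

lemma E_genJ_mem_span:
  assumes "Jgens d \<subseteq> S" "i \<in> {1..d}" "j \<in> {1..d}"
  shows "E (genJ i j) \<in> span (E ` S)"
proof (cases i j rule: linorder_cases)
  case less
  then show ?thesis using assms by (intro span_base) auto
next
  case equal
  then show ?thesis by (simp add: E_genJ_refl span_zero)
next
  case greater
  then have "E (genJ j i) \<in> span (E ` S)"
    using assms by (intro span_base) auto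
  then show ?thesis
    using E_genJ_swap[of i j] by (simp add: span_neg)
qed

lemma gen_bracket_mem_algebra:
  assumes "a \<in> gens d" "b \<in> gens d"
  shows "gen_bracket c a b \<in> span (E ` gens d)"
proof -
  have "E genM \<in> span (E ` gens d)" "E genH \<in> span (E ` gens d)"
    by (auto simp: gens_def intro!: span_base)
  moreover have "E (genP i) \<in> span (E ` gens d)" "E (genK i) \<in> span (E ` gens d)"
    if "i \<in> {1..d}" for i
    using that by (auto simp: gens_def intro!: span_base)
  moreover have "E (genJ i j) \<in> span (E ` gens d)" if "i \<in> {1..d}" "j \<in> {1..d}" for i j
    using that by (intro E_genJ_mem_span[of d]) (auto simp: gens_def)
  ultimately show ?thesis
    using assms [unfolded gens_def]
    by (cases a; cases b) (auto intro!: span_add span_diff span_neg span_scale span_zero)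
qed

lemma gen_bracket_mem_isotropy:
  assumes "a \<in> Kgens d \<union> Jgens d" "b \<in> Kgens d \<union> Jgens d"
  shows "gen_bracket c a b \<in> span (E ` (Kgens d \<union> Jgens d))" (is "_ \<in> ?V")
proof -
  have "E (genK i) \<in> ?V" if "i \<in> {1..d}" for i
    using that by (auto intro!: span_base)
  moreover have "E (genJ i j) \<in> ?V" if "i \<in> {1..d}" "j \<in> {1..d}" for i j
    using that by (intro E_genJ_mem_span[of d]) auto
  ultimately show ?thesis
    using assms
    by (cases a; cases b) (auto intro!: span_add span_diff span_neg span_scale span_zero)
qed

lemma lie_algebra_model:
  assumes "admissible c"
  shows "lie_algebra (span (E ` gens d)) (vec_bracket c)"
proof -
  have "vec_bracket c x x = 0" for x
    using vec_bracket_antisym[of c x x] by (simp add: eq_neg_iff_add_eq_0 flip: scaleR_2)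
  moreover have "span (E ` gens d) \<subseteq> span (range E)"
    by (intro span_mono) auto
  then have "jacobiator c x y z = 0"
    if "x \<in> span (E ` gens d)" "y \<in> span (E ` gens d)" "z \<in> span (E ` gens d)" for x y z
    using that jacobiator_span[OF assms] by blast
  moreover have "vec_bracket c x y \<in> span (E ` gens d)"
    if "x \<in> span (E ` gens d)" "y \<in> span (E ` gens d)" for x y
    using that gen_bracket_mem_algebra by (blast intro: vec_bracket_mem_subspace subspace_span)
  moreover have "finite (E ` gens d)"
    by (simp add: finite_gens)
  ultimately show ?thesis
    unfolding lie_algebra_def jacobiator_def by (auto simp: vec_bracket_bilinear_simps)
qed

lemma adapted_basis_model:
  assumes "admissible c"
  shows "adapted_basis d (model c d) E"
  using lie_algebra_model[OF assms] frame_E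
  by (auto simp: adapted_basis_def model_def ambient_aristotelian_def vec_bracket_E)

lemma commutators_model:
  assumes "admissible c"
  shows "commutators d (bracket (model c d)) E c"
  by (simp add: commutators_def model_def vec_bracket_E)

lemma klein_pair_model:
  assumes "admissible c"
  shows "klein_pair (algebra (model c d)) (bracket (model c d)) (isotropy (model c d))"
proof -
  have "vec_bracket c x y \<in> span (E ` (Kgens d \<union> Jgens d))"
    if "x \<in> span (E ` (Kgens d \<union> Jgens d))" "y \<in> span (E ` (Kgens d \<union> Jgens d))" for x y
    using that gen_bracket_mem_isotropy by (blast intro: vec_bracket_mem_subspace subspace_span)
  moreover have "span (E ` (Kgens d \<union> Jgens d)) \<subseteq> span (E ` gens d)"
    by (intro span_mono) (auto simp: gens_def)
  ultimately show ?thesis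
    using lie_algebra_model[OF assms] by (simp add: klein_pair_def model_def)
qed

section \<open>Coordinates of the isotropy action and effectivity\<close>

lemma lookup_E [simp]:
  "Poly_Mapping.lookup (E genM) b = (if b = genM then 1 else 0)"
  "Poly_Mapping.lookup (E genH) b = (if b = genH then 1 else 0)"
  "Poly_Mapping.lookup (E (genP i)) b = (if b = genP i then 1 else 0)"
  "Poly_Mapping.lookup (E (genK i)) b = (if b = genK i then 1 else 0)"
  "Poly_Mapping.lookup (E (genJ i j)) genM = 0"
  "Poly_Mapping.lookup (E (genJ i j)) genH = 0"
  "Poly_Mapping.lookup (E (genJ i j)) (genP k) = 0"
  "Poly_Mapping.lookup (E (genJ i j)) (genK k) = 0"
  "i < j \<Longrightarrow> Poly_Mapping.lookup (E (genJ i j)) (genJ k l) = (if k = i \<and> l = j then 1 else 0)"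
  by (auto simp: E.simps lookup_single)

text \<open>The entry of the antisymmetric matrix formed by the rotation part of \<open>x\<close>;
  the subtraction supplies the entries below the diagonal, which have no basis vector of their
  own.\<close>

definition rotation_entry :: "vec \<Rightarrow> nat \<Rightarrow> nat \<Rightarrow> real" where
  "rotation_entry x i j = Poly_Mapping.lookup x (genJ i j) - Poly_Mapping.lookup x (genJ j i)"

lemma rotation_entry_swap: "rotation_entry x j i = - rotation_entry x i j"
  by (simp add: rotation_entry_def)

lemma rotation_entry_linear:
  "rotation_entry (x + y) i j = rotation_entry x i j + rotation_entry y i j"
  "rotation_entry (r *\<^sub>R x) i j = r * rotation_entry x i j"
  by (simp_all add: rotation_entry_def lookup_add algebra_simps)

lemma bilinear_lookup_vec_bracket: "bilinear (\<lambda>x y. Poly_Mapping.lookup (vec_bracket c x y) a)"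
  by (auto simp: bilinear_def vec_bracket_bilinear_simps lookup_add intro!: linearI)

lemma sum_mult_delta:
  fixes f :: "nat \<Rightarrow> real"
  assumes "Suc 0 \<le> j" "j \<le> d"
  shows "(\<Sum>i=Suc 0..d. f i * (if i = j then 1 else 0)) = f j"
proof -
  have "(\<Sum>i=Suc 0..d. f i * (if i = j then 1 else 0)) = (\<Sum>i=Suc 0..d. if i = j then f i else 0)"
    by (intro sum.cong) auto
  with assms show ?thesis by simp
qed

text \<open>Both sides are bilinear, so agreement on generators suffices. Modulo the isotropy,
  boosts take \<open>P\<close> to \<open>H\<close> and \<open>M\<close> and take \<open>H\<close> to
  \<open>P\<close>, while rotations act on \<open>P\<close> through their matrix.\<close>

lemma lookup_isotropy_bracket:
  assumes adm: "admissible c"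
    and x: "x \<in> span (E ` (Kgens d \<union> Jgens d))" and v: "v \<in> span (E ` gens d)"
  shows "Poly_Mapping.lookup (vec_bracket c x v) genM =
      kp_M c * (\<Sum>i=1..d. Poly_Mapping.lookup x (genK i) * Poly_Mapping.lookup v (genP i))" (is ?M)
    and "Poly_Mapping.lookup (vec_bracket c x v) genH =
      kp_H c * (\<Sum>i=1..d. Poly_Mapping.lookup x (genK i) * Poly_Mapping.lookup v (genP i))" (is ?H)
    and "l \<in> {1..d} \<Longrightarrow> Poly_Mapping.lookup (vec_bracket c x v) (genP l) =
      kh_P c * Poly_Mapping.lookup x (genK l) * Poly_Mapping.lookup v genH
      + (\<Sum>j=1..d. rotation_entry x l j * Poly_Mapping.lookup v (genP j))" (is "_ \<Longrightarrow> ?P")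
proof -
  have eq: "f x v = g x v" if "bilinear f" "bilinear g"
    "\<And>a b. a \<in> Kgens d \<union> Jgens d \<Longrightarrow> b \<in> gens d \<Longrightarrow> f (E a) (E b) = g (E a) (E b)"
    for f g :: "vec \<Rightarrow> vec \<Rightarrow> real"
    using that by (intro bilinear_eq[OF that(1,2) order_refl order_refl x v]) auto
  have c: "hm_H c = 0" "mk_P c = 0"
    using adm by (auto simp: admissible_def)
  note bil = bilinear_def lookup_add algebra_simps sum.distrib sum_distrib_left sum_distrib_right
    rotation_entry_linear
  have "bilinear (\<lambda>x v. r * (\<Sum>i=1..d. Poly_Mapping.lookup x (genK i) * Poly_Mapping.lookup v (genP i) :: real))"
    for r
    by (auto simp: bil intro!: linearI)
  then show ?M ?H
    by (rule eq[OF bilinear_lookup_vec_bracket];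
      auto simp: vec_bracket_E gens_def lookup_add lookup_minus sum_mult_delta c)+
  assume l: "l \<in> {1..d}"
  have "bilinear (\<lambda>x v. kh_P c * Poly_Mapping.lookup x (genK l) * Poly_Mapping.lookup v genH
      + (\<Sum>j=1..d. rotation_entry x l j * Poly_Mapping.lookup v (genP j)))"
    by (auto simp: bil intro!: linearI)
  then show ?P
    by (rule eq[OF bilinear_lookup_vec_bracket])
      (use l in \<open>auto simp: vec_bracket_E gens_def lookup_add lookup_minus c
        rotation_entry_def sum_mult_delta\<close>)
qed

lemma lookup_eq_zero:
  "Poly_Mapping.keys x \<subseteq> S \<Longrightarrow> a \<notin> S \<Longrightarrow> Poly_Mapping.lookup x a = 0"
  by (auto simp: in_keys_iff)

lemma mem_isotropy_iff:
  "x \<in> span (E ` (Kgens d \<union> Jgens d)) \<longleftrightarrow> Poly_Mapping.keys x \<subseteq> Kgens d \<union> Jgens d"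
  by (rule mem_span_E_iff[of _ d]) (auto simp: gens_def)

lemma mem_ideal_iff: "x \<in> span {E genM} \<longleftrightarrow> Poly_Mapping.keys x \<subseteq> {genM}"
  using mem_span_E_iff[of "{genM}" 0] by (simp add: gens_def)

text \<open>Boost coordinates are detected by bracketing with \<open>H\<close> if
  \<open>kh_P c \<noteq> 0\<close>, or with \<open>P\<close> if \<open>kp_H c \<noteq> 0\<close>;
  rotation coordinates by bracketing with \<open>P\<close>. The \<open>M\<close> coordinate is never
  inspected, so the result serves both the Klein pair and its quotient by \<open>M\<close>.\<close>

lemma isotropy_eq_zero:
  assumes adm: "admissible c" and x: "x \<in> span (E ` (Kgens d \<union> Jgens d))"
    and zero: "\<And>v a. v \<in> span (E ` gens d) \<Longrightarrow> a \<in> {genH} \<union> Pgens d \<Longrightarrow>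
      Poly_Mapping.lookup (vec_bracket c v x) a = 0"
  shows "x = 0"
proof -
  have E: "E b \<in> span (E ` gens d)" if "b \<in> gens d" for b
    using that by (simp add: span_base)
  have zero: "Poly_Mapping.lookup (vec_bracket c x (E b)) a = 0"
    if "b \<in> gens d" "a \<in> {genH} \<union> Pgens d" for a b
    using zero[of "E b" a] that vec_bracket_antisym[of c x "E b"] by (simp add: E)
  note coords = lookup_isotropy_bracket[OF adm x E]
  have K: "Poly_Mapping.lookup x (genK i) = 0" if i: "i \<in> {1..d}" for i
  proof (cases "kp_H c = 0")
    case True
    then have "kh_P c \<noteq> 0"
      using adm by (simp add: admissible_def)
    then show ?thesis
      using coords(3)[of genH i] zero[of genH "genP i"] i by (simp add: gens_def)
  next
    case False
    then show ?thesis
      using coords(2)[of "genP i"] zero[of "genP i" genH] i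
      by (simp add: gens_def sum_mult_delta)
  qed
  have J: "Poly_Mapping.lookup x (genJ i j) = 0" if ij: "1 \<le> i" "i < j" "j \<le> d" for i j
  proof -
    have "rotation_entry x i j = 0"
      using coords(3)[of "genP j" i] zero[of "genP j" "genP i"] ij
      by (simp add: gens_def sum_mult_delta)
    \<comment> \<open>The support contains only \<open>genJ\<close> with increasing indices, so the
      matrix entry is a single coordinate.\<close>
    moreover have "Poly_Mapping.lookup x (genJ j i) = 0"
      using x ij by (intro lookup_eq_zero[OF iffD1[OF mem_isotropy_iff]]) auto
    ultimately show ?thesis
      by (simp add: rotation_entry_def)
  qed
  have "Poly_Mapping.keys x \<subseteq> Kgens d \<union> Jgens d"
    using x by (simp only: mem_isotropy_iff)
  moreover have "Poly_Mapping.keys x \<inter> (Kgens d \<union> Jgens d) = {}"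
    using K J by (auto simp: in_keys_iff)
  ultimately have "Poly_Mapping.keys x = {}"
    by blast
  then show "x = 0"
    by simp
qed

lemma lookup_isotropy:
  assumes "x \<in> span (E ` (Kgens d \<union> Jgens d))" "a \<in> {genM, genH} \<union> Pgens d"
  shows "Poly_Mapping.lookup x a = 0"
  using assms by (intro lookup_eq_zero[OF iffD1[OF mem_isotropy_iff]]) auto

lemma isotropy_subset_algebra: "span (E ` (Kgens d \<union> Jgens d)) \<subseteq> span (E ` gens d)"
  by (intro span_mono) (auto simp: gens_def)

text \<open>Brackets with an element of an ideal inside the isotropy stay in the isotropy, which has
  no \<open>H\<close> or \<open>P\<close> coordinates, so \<open>isotropy_eq_zero\<close>
  applies.\<close>

lemma effective_model:
  assumes adm: "admissible c"
  shows "effective (lie_space_of (algebra (model c d)) (bracket (model c d))) (isotropy (model c d))"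
proof -
  have "x = 0"
    if a: "lie_ideal (lie_space_of (span (E ` gens d)) (vec_bracket c)) a"
      "a \<subseteq> span (E ` (Kgens d \<union> Jgens d))" "x \<in> a" for a x
  proof (rule isotropy_eq_zero[OF adm])
    show "x \<in> span (E ` (Kgens d \<union> Jgens d))"
      using a by blast
    fix v b assume "v \<in> span (E ` gens d)" "b \<in> {genH} \<union> Pgens d"
    then have "vec_bracket c v x \<in> span (E ` (Kgens d \<union> Jgens d))"
      using a by (auto simp: lie_ideal_def lie_space_of_def)
    then show "Poly_Mapping.lookup (vec_bracket c v x) b = 0"
      using \<open>b \<in> _\<close> by (intro lookup_isotropy) auto
  qed
  moreover have "0 \<in> a" if "lie_ideal (lie_space_of (span (E ` gens d)) (vec_bracket c)) a" for a
    using that by (simp add: lie_ideal_def lie_space_of_def)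
  ultimately have "a = {0}" if "lie_ideal (lie_space_of (span (E ` gens d)) (vec_bracket c)) a"
      "a \<subseteq> span (E ` (Kgens d \<union> Jgens d))" for a
    using that by blast
  then show ?thesis
    unfolding effective_def model_def by (simp add: lie_space_of_def)
qed

lemma ideal_part_model:
  assumes adm: "admissible c" and x: "x \<in> span (E ` gens d)" and y: "y \<in> span {E genM}"
  shows "vec_bracket c x y \<in> span {E genM}"
proof -
  have "gen_bracket c a genM \<in> span {E genM}" if "a \<in> gens d" for a
    using adm by (cases a) (simp_all add: admissible_def span_zero span_neg span_scale span_base)
  then show ?thesis
    using vec_bracket_mem_subspace[OF x, of y "{genM}" "span {E genM}" c] y by auto
qed

lemma lie_ideal_model:
  assumes adm: "admissible c"
  shows "lie_ideal (lie_space_of (algebra (model c d)) (bracket (model c d))) (ideal_part (model c d))"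
proof -
  have "span {E genM} \<subseteq> span (E ` gens d)"
    by (intro span_mono) (auto simp: gens_def)
  then show ?thesis
    using ideal_part_model[OF adm]
    by (auto simp: lie_ideal_def lie_space_of_def model_def span_zero span_add span_scale)
qed

lemma effective_quotient_model:
  assumes adm: "admissible c"
  shows "effective (quotient_lie (algebra (model c d)) (bracket (model c d)) (ideal_part (model c d)))
    (coset (ideal_part (model c d)) ` isotropy (model c d))"
proof -
  let ?i = "span {E genM}" and ?g = "span (E ` gens d)" and ?h = "span (E ` (Kgens d \<union> Jgens d))"
  have i: "?i \<subseteq> ?g"
    by (intro span_mono) (auto simp: gens_def)
  have "A = ?i"
    if a: "lie_ideal (quotient_lie ?g (vec_bracket c) ?i) a" "a \<subseteq> coset ?i ` ?h" "A \<in> a" for a A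
  proof -
    obtain x where x: "x \<in> ?h" "A = coset ?i x"
      using a by blast
    have "x = 0"
    proof (rule isotropy_eq_zero[OF adm x(1)])
      fix v b assume v: "v \<in> ?g" and b: "b \<in> {genH} \<union> Pgens d"
      have "(\<Union>u\<in>coset ?i v. \<Union>w\<in>A. coset ?i (vec_bracket c u w)) \<in> a"
        using a v by (auto simp: lie_ideal_def)
      also have "(\<Union>u\<in>coset ?i v. \<Union>w\<in>A. coset ?i (vec_bracket c u w)) = coset ?i (vec_bracket c v x)"
        unfolding x(2) using v x(1) isotropy_subset_algebra i ideal_part_model[OF adm]
        by (intro coset_bracket[OF lie_algebra_model[OF adm]]) auto
      finally obtain y where "y \<in> ?h" "coset ?i (vec_bracket c v x) = coset ?i y"
        using a by blast
      then have y: "y \<in> ?h" "vec_bracket c v x - y \<in> ?i"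
        by (auto simp: coset_eq_iff)
      \<comment> \<open>In the quotient the bracket is known only up to a multiple of
        \<open>M\<close>, which does not affect the inspected coordinate.\<close>
      have "Poly_Mapping.lookup z b = 0" if "z \<in> ?i" for z
        using that b by (intro lookup_eq_zero[of z "{genM}"]) (auto simp: mem_ideal_iff)
      from this[OF y(2)] have "Poly_Mapping.lookup (vec_bracket c v x) b = Poly_Mapping.lookup y b"
        by (simp add: lookup_minus)
      also have "\<dots> = 0"
        using b by (intro lookup_isotropy[OF y(1)]) auto
      finally show "Poly_Mapping.lookup (vec_bracket c v x) b = 0" .
    qed
    then show ?thesis
      using x by (simp add: coset_zero)
  qed
  moreover have "?i \<in> a" if "lie_ideal (quotient_lie ?g (vec_bracket c) ?i) a" for a
    using that by (simp add: lie_ideal_def)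
  ultimately have "a = {?i}" if "lie_ideal (quotient_lie ?g (vec_bracket c) ?i) a"
      "a \<subseteq> coset ?i ` ?h" for a
    using that by blast
  then show ?thesis
    unfolding effective_def model_def by simp
qed

lemma universal_triplet_model:
  assumes "admissible c"
  shows "universal_triplet (model c)"
  unfolding universal_triplet_def projectable_triplet_def
  using adapted_basis_model[OF assms] commutators_model[OF assms] klein_pair_model[OF assms]
    effective_model[OF assms] lie_ideal_model[OF assms] effective_quotient_model[OF assms]
  by blast

lemma admissible_triplet_list: "c \<in> triplet_list \<Longrightarrow> admissible c"
  by (auto simp: triplet_list_def g_ambient_family_def bargmann_family_def carroll_family_def
    riemann_family_def lorentz_family_def g_ambient_coeffs_def bargmann_coeffs_def no_coeffs_def
    admissible_def)

subsection \<open>Invariant structures\<close>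

definition model_algebra :: "nat \<Rightarrow> vec set" where
  "model_algebra d = span (E ` gens d)"

definition model_isotropy :: "nat \<Rightarrow> vec set" where
  "model_isotropy d = span (E ` (Kgens d \<union> Jgens d))"

lemma subspace_model [simp]: "subspace (model_algebra d)" "subspace (model_isotropy d)"
  by (simp_all add: model_algebra_def model_isotropy_def)

lemmas lookup_isotropy_bracket' =
  lookup_isotropy_bracket[folded model_isotropy_def model_algebra_def]

lemma quotient_vec_eq: "quotient_vec d a = coset (model_isotropy d) (E a)"
  by (simp only: quotient_vec_def model_isotropy_def)

lemma model_simps [simp]:
  "algebra (model c d) = model_algebra d" "isotropy (model c d) = model_isotropy d"
  "bracket (model c d) = vec_bracket c"
  by (simp_all only: model_def triplet.simps model_isotropy_def model_algebra_def)

lemma homogeneous_space_model [simp]: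
  "points (homogeneous_space (model c d)) = coset (model_isotropy d) ` model_algebra d"
  "origin (homogeneous_space (model c d)) = model_isotropy d"
  by (simp_all add: homogeneous_space_def quotient_space_def)

lemma plus_of_model [simp]:
  "plus_of (homogeneous_space (model c d)) (coset (model_isotropy d) v) (coset (model_isotropy d) w)
    = coset (model_isotropy d) (v + w)"
  by (simp add: homogeneous_space_def quotient_space_def coset_plus)

lemma scale_of_model [simp]:
  "scale_of (homogeneous_space (model c d)) r (coset (model_isotropy d) v)
    = coset (model_isotropy d) (r *\<^sub>R v)"
  by (simp add: homogeneous_space_def quotient_space_def coset_scale)

text \<open>The action is well defined on cosets because the isotropy is a subalgebra.\<close>

lemma isotropy_action_model [simp]:
  assumes "x \<in> model_isotropy d"
  shows "isotropy_action (model c d) x (coset (model_isotropy d) v) =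
    coset (model_isotropy d) (vec_bracket c x v)"
proof -
  have "vec_bracket c x a - vec_bracket c x v \<in> model_isotropy d"
    if "a \<in> coset (model_isotropy d) v" for a
  proof -
    have "vec_bracket c x (a - v) \<in> model_isotropy d"
      using assms that gen_bracket_mem_isotropy subspace_span unfolding model_isotropy_def
      by (blast intro: vec_bracket_mem_subspace dest: mem_coset_iff[THEN iffD1])
    then show ?thesis
      by (simp add: vec_bracket_bilinear_simps)
  qed
  then show ?thesis
    unfolding isotropy_action_def by (simp add: Union_coset)
qed

lemma vec_bracket_isotropy_mem_algebra:
  "x \<in> model_isotropy d \<Longrightarrow> v \<in> model_algebra d \<Longrightarrow> vec_bracket c x v \<in> model_algebra d"
  using isotropy_subset_algebra gen_bracket_mem_algebra subspace_span
  unfolding model_isotropy_def model_algebra_def by (blast intro: vec_bracket_mem_subspace)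

lemma lookup_coset:
  assumes "w \<in> coset (model_isotropy d) v" "a \<in> {genM, genH} \<union> Pgens d"
  shows "Poly_Mapping.lookup w a = Poly_Mapping.lookup v a"
  using lookup_isotropy[of "w - v" d a, folded model_isotropy_def] assms by (simp add: mem_coset_iff lookup_minus)

lemma lookup_representative:
  assumes v: "v \<in> model_algebra d" and a: "a \<in> {genM, genH} \<union> Pgens d"
  shows "Poly_Mapping.lookup (representative d (coset (model_isotropy d) v)) a =
    Poly_Mapping.lookup v a"
proof -
  let ?S = "{genM, genH} \<union> Pgens d"
  have S: "?S \<subseteq> gens d"
    by (auto simp: gens_def)
  \<comment> \<open>The representative is \<open>v\<close> with its boost and rotation coordinates
    dropped.\<close>
  define w where "w = (\<Sum>a\<in>?S. Poly_Mapping.lookup v a *\<^sub>R E a)"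
  have w: "w \<in> span (E ` ?S)"
    unfolding w_def by (intro span_sum span_scale span_base) auto
  have lookup_w: "Poly_Mapping.lookup w a = Poly_Mapping.lookup v a" if "a \<in> ?S" for a
  proof -
    have "Poly_Mapping.lookup w a =
        (\<Sum>b\<in>?S. if b = a then Poly_Mapping.lookup v b else 0)"
      unfolding w_def lookup_sum using S
      by (intro sum.cong) (auto simp: E_gens lookup_single)
    then show ?thesis
      using that by simp
  qed
  have w_coset: "w \<in> coset (model_isotropy d) v"
  proof -
    have "Poly_Mapping.keys w \<subseteq> gens d" "Poly_Mapping.keys v \<subseteq> gens d"
      using w v S mem_span_E_iff[of ?S d w] mem_span_E_iff[of "gens d" d v]
      unfolding model_algebra_def by auto
    then have "Poly_Mapping.keys (w - v) \<subseteq> gens d"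
      using keys_diff[of w v] by blast
    moreover have "Poly_Mapping.keys (w - v) \<inter> ?S = {}"
      using lookup_w by (auto simp: in_keys_iff lookup_minus)
    ultimately have "Poly_Mapping.keys (w - v) \<subseteq> Kgens d \<union> Jgens d"
      unfolding gens_def by blast
    then show ?thesis
      by (simp only: mem_coset_iff model_isotropy_def mem_isotropy_iff)
  qed
  have "representative d (coset (model_isotropy d) v) = w"
    unfolding representative_def
  proof (rule the_equality)
    \<comment> \<open>Coordinates in \<open>?S\<close> are constant on the coset, and all others
      vanish in the span, so \<open>u\<close> has no freedom.\<close>
    fix u assume u: "u \<in> coset (model_isotropy d) v \<and> u \<in> span (E ` ?S)"
    show "u = w"
    proof (rule poly_mapping_eqI)
      fix b
      show "Poly_Mapping.lookup u b = Poly_Mapping.lookup w b"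
      proof (cases "b \<in> ?S")
        case True
        then show ?thesis
          using u lookup_coset w_coset by metis
      next
        case False
        then show ?thesis
          using u w mem_span_E_iff[OF S] lookup_eq_zero by metis
      qed
    qed
  qed (use w w_coset in blast)
  then show ?thesis
    using lookup_w a by simp
qed

lemma dual_coset [simp]:
  assumes "v \<in> model_algebra d"
  shows "M_dual d (coset (model_isotropy d) v) = Poly_Mapping.lookup v genM"
    and "H_dual d (coset (model_isotropy d) v) = Poly_Mapping.lookup v genH"
    and "w \<in> model_algebra d \<Longrightarrow>
      PP_dual d (coset (model_isotropy d) v) (coset (model_isotropy d) w) =
      (\<Sum>i=1..d. Poly_Mapping.lookup v (genP i) * Poly_Mapping.lookup w (genP i))"
  using assms
  by (simp_all add: M_dual_def H_dual_def PP_dual_def P_dual_def lookup_representative)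

lemma invariant_vector_model:
  assumes "a \<in> gens d" "\<And>b. b \<in> Kgens d \<union> Jgens d \<Longrightarrow> gen_bracket c b a \<in> model_isotropy d"
  shows "invariant_vector (model c d) (quotient_vec d a)"
proof -
  have "vec_bracket c x (E a) \<in> model_isotropy d" if "x \<in> model_isotropy d" for x
    using that assms(2) subspace_model(2)[of d] unfolding model_isotropy_def
    by (intro vec_bracket_mem_subspace[of x _ "E a" "{a}"]) (auto intro: span_base)
  then have "coset (model_isotropy d) (vec_bracket c x (E a)) = model_isotropy d"
    if "x \<in> model_isotropy d" for x
    using that coset_eq_iff[of "model_isotropy d" _ 0] by (simp add: coset_zero)
  then show ?thesis
    using assms(1) by (simp add: invariant_vector_def quotient_vec_eq model_algebra_def span_base)
qed

lemma invariant_M: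
  assumes "admissible c"
  shows "invariant_vector (model c d) (quotient_vec d genM)"
proof (rule invariant_vector_model)
  fix b assume "b \<in> Kgens d \<union> Jgens d"
  then show "gen_bracket c b genM \<in> model_isotropy d"
    using assms by (auto simp: admissible_def subspace_0)
qed (simp add: gens_def)

lemma invariant_H:
  assumes "kh_P c = 0"
  shows "invariant_vector (model c d) (quotient_vec d genH)"
proof (rule invariant_vector_model)
  fix b assume "b \<in> Kgens d \<union> Jgens d"
  moreover from this have "E b \<in> model_isotropy d"
    by (simp only: model_isotropy_def span_base imageI)
  ultimately show "gen_bracket c b genH \<in> model_isotropy d"
    using assms by (auto simp: subspace_0 subspace_scale)
qed (simp add: gens_def)

lemma linear_form_modelI:
  assumes "\<And>v. v \<in> model_algebra d \<Longrightarrow> \<psi> (coset (model_isotropy d) v) = r * Poly_Mapping.lookup v a"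
  shows "linear_form (homogeneous_space (model c d)) \<psi>"
  using assms by (auto simp: linear_form_def subspace_add subspace_scale lookup_add algebra_simps)

text \<open>Brackets with the isotropy acquire an \<open>M\<close> component only from
  \<open>[K, P]\<close>, with coefficient \<open>kp_M c\<close>.\<close>

lemma invariant_M_dual:
  assumes "admissible c" "kp_M c = 0"
  shows "invariant_form (model c d) (M_dual d)"
  using assms linear_form_modelI[of d "M_dual d" 1 genM c]
  by (auto simp: invariant_form_def vec_bracket_isotropy_mem_algebra
    lookup_isotropy_bracket')

lemma invariant_H_dual:
  assumes "admissible c" "kp_H c = 0"
  shows "invariant_form (model c d) (\<lambda>v. - H_dual d v)"
  using assms linear_form_modelI[of d "\<lambda>v. - H_dual d v" "-1" genH c]
  by (auto simp: invariant_form_def vec_bracket_isotropy_mem_algebra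
    lookup_isotropy_bracket')

text \<open>The antisymmetric action of the rotations cancels, leaving only the boost terms.\<close>

lemma PP_isotropy_bracket:
  assumes adm: "admissible c" and x: "x \<in> model_isotropy d"
    and v: "v \<in> model_algebra d" and w: "w \<in> model_algebra d"
  shows "(\<Sum>i=1..d. Poly_Mapping.lookup (vec_bracket c x v) (genP i) * Poly_Mapping.lookup w (genP i))
    + (\<Sum>i=1..d. Poly_Mapping.lookup v (genP i) * Poly_Mapping.lookup (vec_bracket c x w) (genP i))
    = kh_P c * (Poly_Mapping.lookup v genH *
          (\<Sum>i=1..d. Poly_Mapping.lookup x (genK i) * Poly_Mapping.lookup w (genP i))
        + Poly_Mapping.lookup w genH *
          (\<Sum>i=1..d. Poly_Mapping.lookup x (genK i) * Poly_Mapping.lookup v (genP i)))"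
    (is "?L = ?R")
proof -
  let ?p = "\<lambda>u i. Poly_Mapping.lookup u (genP i)" and ?r = "rotation_entry x"
  have "(\<Sum>i=1..d. \<Sum>j=1..d. ?r i j * ?p w j * ?p v i)
      = (\<Sum>i=1..d. \<Sum>j=1..d. ?r j i * ?p w i * ?p v j)"
    by (rule sum.swap)
  also have "\<dots> = - (\<Sum>i=1..d. \<Sum>j=1..d. ?r i j * ?p v j * ?p w i)"
    unfolding sum_negf[symmetric]
    by (intro sum.cong refl, subst rotation_entry_swap) simp
  finally have "(\<Sum>i=1..d. \<Sum>j=1..d. ?r i j * ?p v j * ?p w i)
      + (\<Sum>i=1..d. \<Sum>j=1..d. ?r i j * ?p w j * ?p v i) = 0"
    by simp
  then show ?thesis
    using lookup_isotropy_bracket'(3)[OF adm x v] lookup_isotropy_bracket'(3)[OF adm x w]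
    by (simp add: algebra_simps sum.distrib sum_distrib_left)
qed

text \<open>One criterion for all the bilinear forms that occur: \<open>r\<close> weighs the square
  of the dual of \<open>H\<close>, \<open>s\<close> its symmetric product with the dual of
  \<open>M\<close>. Rotations act antisymmetrically and drop out, and the hypothesis cancels the
  boost terms. It is asked only on \<open>W\<close>, so that forms on a kernel are covered.\<close>

lemma invariant_sym_form_on_modelI:
  assumes adm: "admissible c" and W: "\<And>A. A \<in> W \<Longrightarrow> \<exists>v\<in>model_algebra d. A = coset (model_isotropy d) v"
    and \<gamma>: "\<And>v w. v \<in> model_algebra d \<Longrightarrow> w \<in> model_algebra d \<Longrightarrow>
      \<gamma> (coset (model_isotropy d) v) (coset (model_isotropy d) w) =
        r * Poly_Mapping.lookup v genH * Poly_Mapping.lookup w genH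
        + s * (Poly_Mapping.lookup v genM * Poly_Mapping.lookup w genH
             + Poly_Mapping.lookup v genH * Poly_Mapping.lookup w genM)
        + (\<Sum>i=1..d. Poly_Mapping.lookup v (genP i) * Poly_Mapping.lookup w (genP i))"
    and inv: "\<And>v w. v \<in> model_algebra d \<Longrightarrow> w \<in> model_algebra d \<Longrightarrow>
      coset (model_isotropy d) v \<in> W \<Longrightarrow> coset (model_isotropy d) w \<in> W \<Longrightarrow>
      (r * kp_H c + s * kp_M c + kh_P c) * Poly_Mapping.lookup v genH = 0 \<and>
      s * kp_H c * Poly_Mapping.lookup v genM = 0"
  shows "invariant_sym_form_on (model c d) W \<gamma>"
proof -
  have "sym_bilinear_form_on (homogeneous_space (model c d)) W \<gamma>"
    unfolding sym_bilinear_form_on_def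
    by (auto dest!: W simp: \<gamma> subspace_add subspace_scale lookup_add algebra_simps sum.distrib
      sum_distrib_left)
  moreover have "- \<gamma> (coset (model_isotropy d) (vec_bracket c x v)) (coset (model_isotropy d) w)
      - \<gamma> (coset (model_isotropy d) v) (coset (model_isotropy d) (vec_bracket c x w)) = 0"
    if x: "x \<in> model_isotropy d" and v: "v \<in> model_algebra d" and w: "w \<in> model_algebra d"
      and W: "coset (model_isotropy d) v \<in> W" "coset (model_isotropy d) w \<in> W" for x v w
  proof -
    \<comment> \<open>The pairing of the boost part of \<open>x\<close> with the \<open>P\<close>
      part of \<open>u\<close>, in terms of which all boost contributions are written.\<close>
    define S where "S u = (\<Sum>i=1..d. Poly_Mapping.lookup x (genK i) * Poly_Mapping.lookup u (genP i))" for u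
    note xv = vec_bracket_isotropy_mem_algebra[OF x v, of c]
    note xw = vec_bracket_isotropy_mem_algebra[OF x w, of c]
    note br = lookup_isotropy_bracket'(1,2)[OF adm x v, folded S_def]
      lookup_isotropy_bracket'(1,2)[OF adm x w, folded S_def]
    show ?thesis
      unfolding \<gamma>[OF xv w] \<gamma>[OF v xw] br
      using PP_isotropy_bracket[OF adm x v w, folded S_def] inv[OF v w W] inv[OF w v W(2,1)]
      by algebra
  qed
  then have "- \<gamma> (isotropy_action (model c d) x A) B - \<gamma> A (isotropy_action (model c d) x B) = 0"
    if "x \<in> model_isotropy d" "A \<in> W" "B \<in> W" for x A B
    using that W[of A] W[of B] by auto
  ultimately show ?thesis
    by (simp add: invariant_sym_form_on_def)
qed

lemma keys_algebra: "v \<in> model_algebra d \<Longrightarrow> Poly_Mapping.keys v \<subseteq> gens d"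
  using mem_span_E_iff[of "gens d" d v] unfolding model_algebra_def by simp

lemma leibnizian_model:
  assumes adm: "admissible c" and H: "kp_H c = 0"
  shows "leibnizian (model c d) (quotient_vec d genM) (\<lambda>v. - H_dual d v) (PP_dual d)"
proof -
  let ?c = "coset (model_isotropy d)"
  let ?W = "form_kernel (homogeneous_space (model c d)) (\<lambda>v. - H_dual d v)"
  have E: "E genM \<in> model_algebra d" "E genH \<in> model_algebra d"
    by (auto simp: model_algebra_def gens_def intro!: span_base)
  have W: "A \<in> ?W \<longleftrightarrow> (\<exists>v\<in>model_algebra d. A = ?c v \<and> Poly_Mapping.lookup v genH = 0)" for A
    by (auto simp: form_kernel_def)
  have "?c (E genM) \<noteq> model_isotropy d"
  proof
    assume "?c (E genM) = model_isotropy d"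
    then have "E genM \<in> model_isotropy d"
      using coset_eq_iff[of "model_isotropy d" "E genM" 0] by (simp add: coset_zero)
    then show False
      using lookup_isotropy[of "E genM" d genM, folded model_isotropy_def] by simp
  qed
  moreover have "invariant_sym_form_on (model c d) ?W (PP_dual d)"
    by (rule invariant_sym_form_on_modelI[OF adm, where r = 0 and s = 0])
      (auto simp: form_kernel_def)
  moreover have "PP_dual d A A \<ge> 0" if "A \<in> ?W" for A
    using that by (auto simp: W intro!: sum_nonneg)
  moreover have "{A \<in> ?W. \<forall>B\<in>?W. PP_dual d A B = 0} = {?c (r *\<^sub>R E genM) | r. True}" (is "?L = ?R")
  proof
    show "?R \<subseteq> ?L"
      using E by (auto simp: W subspace_scale intro!: bexI[of _ "_ *\<^sub>R E genM"])
    show "?L \<subseteq> ?R"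
    proof
      fix A assume A: "A \<in> ?L"
      then obtain v where v: "v \<in> model_algebra d" "A = ?c v" "Poly_Mapping.lookup v genH = 0"
        by (auto simp: W)
      \<comment> \<open>Testing an element of the radical against itself gives a vanishing sum of
        squares.\<close>
      have "PP_dual d A A = 0"
        using A by blast
      then have P: "Poly_Mapping.lookup v (genP i) = 0" if "i \<in> {1..d}" for i
        using that v by (simp add: sum_nonneg_eq_0_iff)
      \<comment> \<open>Removing the \<open>M\<close> part leaves only boost and rotation
        coordinates, hence an element of the isotropy.\<close>
      let ?u = "v - Poly_Mapping.lookup v genM *\<^sub>R E genM"
      have "?u \<in> model_algebra d"
        using v E by (simp add: subspace_diff subspace_scale)
      moreover have "Poly_Mapping.keys ?u \<inter> ({genM, genH} \<union> Pgens d) = {}"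
        using v P by (auto simp: in_keys_iff lookup_minus)
      ultimately have "Poly_Mapping.keys ?u \<subseteq> Kgens d \<union> Jgens d"
        using keys_algebra[of ?u d] unfolding gens_def by blast
      then have "?u \<in> model_isotropy d"
        by (simp only: model_isotropy_def mem_isotropy_iff)
      then have "A = ?c (Poly_Mapping.lookup v genM *\<^sub>R E genM)"
        using v by (simp add: coset_eq_iff)
      then show "A \<in> ?R" by blast
    qed
  qed
  moreover have "\<exists>A\<in>?c ` model_algebra d. - H_dual d A \<noteq> 0"
    using E by (intro bexI[of _ "?c (E genH)"]) auto
  ultimately show ?thesis
    using invariant_M[OF adm] invariant_H_dual[OF adm H] E
    by (simp add: leibnizian_def quotient_vec_eq)
qed

section \<open>Metric structures of the five families\<close>

lemma g_ambient_model:
  assumes "c \<in> g_ambient_family"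
  shows "g_ambient (model c d) (quotient_vec d genM) (\<lambda>v. - H_dual d v) (PP_dual d) (M_dual d)"
proof -
  have adm: "admissible c"
    using assms by (intro admissible_triplet_list) (simp add: triplet_list_def)
  have "kp_H c = 0" "kp_M c = 0"
    using assms by (auto simp: g_ambient_family_def g_ambient_coeffs_def no_coeffs_def)
  moreover have "E genM \<in> model_algebra d"
    by (auto simp: model_algebra_def gens_def intro!: span_base)
  ultimately show ?thesis
    using leibnizian_model[OF adm] invariant_M_dual[OF adm]
    by (simp add: g_ambient_def quotient_vec_eq)
qed

lemma bargmannian_model:
  assumes "c \<in> bargmann_family"
  shows "bargmannian (model c d) (quotient_vec d genM) (\<lambda>v. - H_dual d v) (PP_dual d)
    (\<lambda>v w. - M_dual d v * H_dual d w - H_dual d v * M_dual d w + PP_dual d v w)"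
proof -
  have adm: "admissible c"
    using assms by (intro admissible_triplet_list) (simp add: triplet_list_def)
  have c: "kp_H c = 0" "kp_M c = 1" "kh_P c = 1"
    using assms by (auto simp: bargmann_family_def bargmann_coeffs_def no_coeffs_def)
  have "E genM \<in> model_algebra d"
    by (auto simp: model_algebra_def gens_def intro!: span_base)
  moreover have "invariant_sym_form_on (model c d) (coset (model_isotropy d) ` model_algebra d)
    (\<lambda>v w. - M_dual d v * H_dual d w - H_dual d v * M_dual d w + PP_dual d v w)"
    \<comment> \<open>The boost terms cancel because \<open>kp_M c\<close> and \<open>kh_P c\<close>
      are equal and \<open>kp_H c\<close> vanishes.\<close>
    by (rule invariant_sym_form_on_modelI[OF adm, where r = 0 and s = "-1"]) (auto simp: c)
  ultimately show ?thesis
    using leibnizian_model[OF adm c(1)]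
    by (auto simp: bargmannian_def quotient_vec_eq form_kernel_def invariant_sym_form_def)
qed

lemma invariant_sym_form_model:
  assumes "admissible c" "r * kp_H c + kh_P c = 0"
  shows "invariant_sym_form (model c d) (\<lambda>v w. r * H_dual d v * H_dual d w + PP_dual d v w)"
  unfolding invariant_sym_form_def homogeneous_space_model
  by (rule invariant_sym_form_on_modelI[OF assms(1), where r = r and s = 0])
    (use assms(2) in auto)

lemma carroll_model:
  assumes "c \<in> carroll_family"
  shows "invariant_vector (model c d) (quotient_vec d genM) \<and> invariant_form (model c d) (M_dual d) \<and>
    invariant_vector (model c d) (quotient_vec d genH) \<and> invariant_sym_form (model c d) (PP_dual d)"
proof -
  have "admissible c"
    using assms by (intro admissible_triplet_list) (simp add: triplet_list_def)
  moreover have "kp_M c = 0" "kh_P c = 0"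
    using assms by (auto simp: carroll_family_def no_coeffs_def)
  ultimately show ?thesis
    using invariant_M invariant_M_dual invariant_H invariant_sym_form_model[of c 0 d] by simp
qed

lemma riemann_model:
  assumes "c \<in> riemann_family"
  shows "invariant_vector (model c d) (quotient_vec d genM) \<and> invariant_form (model c d) (M_dual d) \<and>
    invariant_sym_form (model c d) (\<lambda>v w. H_dual d v * H_dual d w + PP_dual d v w)"
proof -
  have "admissible c"
    using assms by (intro admissible_triplet_list) (simp add: triplet_list_def)
  moreover have "kp_M c = 0" "kp_H c = 1" "kh_P c = -1"
    using assms by (auto simp: riemann_family_def no_coeffs_def)
  ultimately show ?thesis
    using invariant_M invariant_M_dual invariant_sym_form_model[of c 1 d] by simp
qed

lemma lorentz_model:
  assumes "c \<in> lorentz_family"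
  shows "invariant_vector (model c d) (quotient_vec d genM) \<and> invariant_form (model c d) (M_dual d) \<and>
    invariant_sym_form (model c d) (\<lambda>v w. - H_dual d v * H_dual d w + PP_dual d v w)"
proof -
  have "admissible c"
    using assms by (intro admissible_triplet_list) (simp add: triplet_list_def)
  moreover have "kp_M c = 0" "kp_H c = 1" "kh_P c = 1"
    using assms by (auto simp: lorentz_family_def no_coeffs_def)
  ultimately show ?thesis
    using invariant_M invariant_M_dual invariant_sym_form_model[of c "-1" d] by simp
qed

subsection \<open>Isomorphisms with the models\<close>

lemma lie_algebraD:
  assumes "lie_algebra g br"
  shows "subspace g" "x \<in> g \<Longrightarrow> y \<in> g \<Longrightarrow> br x y \<in> g"
    "x \<in> g \<Longrightarrow> y \<in> g \<Longrightarrow> z \<in> g \<Longrightarrow> br (x + y) z = br x z + br y z"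
    "x \<in> g \<Longrightarrow> y \<in> g \<Longrightarrow> z \<in> g \<Longrightarrow> br z (x + y) = br z x + br z y"
    "x \<in> g \<Longrightarrow> y \<in> g \<Longrightarrow> br (r *\<^sub>R x) y = r *\<^sub>R br x y"
    "x \<in> g \<Longrightarrow> y \<in> g \<Longrightarrow> br x (r *\<^sub>R y) = r *\<^sub>R br x y"
    "x \<in> g \<Longrightarrow> br x x = 0"
    "x \<in> g \<Longrightarrow> y \<in> g \<Longrightarrow> z \<in> g \<Longrightarrow> br x (br y z) + br y (br z x) + br z (br x y) = 0"
  using assms by (simp_all add: lie_algebra_def)

lemma lie_algebra_antisym:
  assumes "lie_algebra g br" "x \<in> g" "y \<in> g"
  shows "br y x = - br x y"
proof -
  note L = lie_algebraD[OF assms(1)]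
  have "x + y \<in> g"
    using L(1) assms by (simp add: subspace_add)
  then have "br (x + y) (x + y) = 0" "br x x = 0" "br y y = 0"
    using L(7) assms by auto
  then show ?thesis
    using assms by (simp add: L(3,4) \<open>x + y \<in> g\<close> eq_neg_iff_add_eq_0 add.commute)
qed

lemma adapted_basisD:
  assumes "adapted_basis d T e"
  shows "lie_algebra (algebra T) (bracket T)" "algebra T = span (e ` gens d)"
    "independent (e ` gens d)" "inj_on e (gens d)"
    "i \<in> {1..d} \<Longrightarrow> j \<in> {1..d} \<Longrightarrow> e (genJ j i) = - e (genJ i j)"
    "scalars T = span (e ` {genM, genH})" "vectors T = span (e ` (Pgens d \<union> Kgens d))"
    "rotations T = span (e ` Jgens d)" "isotropy T = span (e ` (Kgens d \<union> Jgens d))"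
    "ideal_part T = span (e ` {genM})"
proof -
  have fr: "frame d (algebra T) e"
    using assms unfolding adapted_basis_def ambient_aristotelian_def by blast
  then show "independent (e ` gens d)" "inj_on e (gens d)" "algebra T = span (e ` gens d)"
    unfolding frame_def by blast+
  show "e (genJ j i) = - e (genJ i j)" if "i \<in> {1..d}" "j \<in> {1..d}"
    using fr that unfolding frame_def by blast
qed (use assms in \<open>simp_all add: adapted_basis_def ambient_aristotelian_def\<close>)

lemma ambient_aristotelianD:
  assumes "ambient_aristotelian d g br e" "i \<in> {1..d}" "j \<in> {1..d}"
  shows "k \<in> {1..d} \<Longrightarrow> l \<in> {1..d} \<Longrightarrow> br (e (genJ i j)) (e (genJ k l)) =
      kdelta j k *\<^sub>R e (genJ i l) - kdelta j l *\<^sub>R e (genJ i k)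
      + kdelta i l *\<^sub>R e (genJ j k) - kdelta i k *\<^sub>R e (genJ j l)"
    "k \<in> {1..d} \<Longrightarrow> br (e (genJ i j)) (e (genP k)) =
      - kdelta i k *\<^sub>R e (genP j) + kdelta j k *\<^sub>R e (genP i)"
    "k \<in> {1..d} \<Longrightarrow> br (e (genJ i j)) (e (genK k)) =
      - kdelta i k *\<^sub>R e (genK j) + kdelta j k *\<^sub>R e (genK i)"
    "br (e (genJ i j)) (e genM) = 0" "br (e (genJ i j)) (e genH) = 0"
  using assms unfolding ambient_aristotelian_def by blast+

lemma commutatorsD:
  assumes "commutators d br e c"
  shows "br (e genH) (e genM) = hm_H c *\<^sub>R e genH + hm_M c *\<^sub>R e genM"
    "i \<in> {1..d} \<Longrightarrow> br (e (genK i)) (e genH) = kh_K c *\<^sub>R e (genK i) + kh_P c *\<^sub>R e (genP i)"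
    "i \<in> {1..d} \<Longrightarrow> br (e genH) (e (genP i)) = hp_K c *\<^sub>R e (genK i) + hp_P c *\<^sub>R e (genP i)"
    "i \<in> {1..d} \<Longrightarrow> br (e genM) (e (genK i)) = mk_K c *\<^sub>R e (genK i) + mk_P c *\<^sub>R e (genP i)"
    "i \<in> {1..d} \<Longrightarrow> br (e genM) (e (genP i)) = mp_K c *\<^sub>R e (genK i) + mp_P c *\<^sub>R e (genP i)"
    "i \<in> {1..d} \<Longrightarrow> j \<in> {1..d} \<Longrightarrow> br (e (genK i)) (e (genP j)) =
      kdelta i j *\<^sub>R (kp_H c *\<^sub>R e genH + kp_M c *\<^sub>R e genM) + kp_J c *\<^sub>R e (genJ i j)"
    "i \<in> {1..d} \<Longrightarrow> j \<in> {1..d} \<Longrightarrow> br (e (genK i)) (e (genK j)) = kk_J c *\<^sub>R e (genJ i j)"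
    "i \<in> {1..d} \<Longrightarrow> j \<in> {1..d} \<Longrightarrow> br (e (genP i)) (e (genP j)) = pp_J c *\<^sub>R e (genJ i j)"
  using assms unfolding commutators_def by blast+

text \<open>The order in which the brackets are prescribed. No linear order matches all of them,
  since \<open>[H, M]\<close>, \<open>[M, K]\<close> and \<open>[K, H]\<close> form a cycle;
  \<open>[K, M]\<close> is therefore reversed separately.\<close>

fun bracket_order :: "gen \<Rightarrow> nat" where
  "bracket_order (genJ _ _) = 0" | "bracket_order (genK _) = 1" | "bracket_order genH = 2"
| "bracket_order genM = 3" | "bracket_order (genP _) = 4"

text \<open>A linearly independent frame lets the assignment extend linearly to the whole
  surrounding space. It is injective on the algebra because it carries a basis to an independent
  set, and antisymmetry settles the redundant rotations.\<close>

lemma coordinate_map: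
  assumes e: "adapted_basis d T e"
  obtains \<phi> where "linear \<phi>" "\<And>a. a \<in> gens d \<Longrightarrow> \<phi> (e a) = E a"
    "\<And>i j. i \<in> {1..d} \<Longrightarrow> j \<in> {1..d} \<Longrightarrow> \<phi> (e (genJ i j)) = E (genJ i j)"
    "inj_on \<phi> (algebra T)"
proof -
  note e' = adapted_basisD[OF e]
  obtain \<phi> where \<phi>: "linear \<phi>" "\<And>x. x \<in> e ` gens d \<Longrightarrow> \<phi> x = E (inv_into (gens d) e x)"
    using linear_independent_extend[OF e'(3), of "\<lambda>x. E (inv_into (gens d) e x)"] by blast
  have gen: "\<phi> (e a) = E a" if "a \<in> gens d" for a
    using that \<phi>(2)[of "e a"] e'(4) by simp
  have J: "\<phi> (e (genJ i j)) = E (genJ i j)" if ij: "i \<in> {1..d}" "j \<in> {1..d}" for i j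
  proof (cases i j rule: linorder_cases)
    case less
    then show ?thesis
      using ij by (intro gen) (auto simp: gens_def)
  next
    case equal
    then have "e (genJ i j) = 0"
      using e'(5)[OF ij] by (simp add: eq_neg_iff_add_eq_0 flip: scaleR_2)
    then show ?thesis
      using equal \<phi>(1) by (simp add: E_genJ_refl linear_0)
  next
    case greater
    then have "\<phi> (e (genJ j i)) = E (genJ j i)"
      using ij by (intro gen) (auto simp: gens_def)
    then show ?thesis
      using e'(5)[OF ij(2,1)] E_genJ_swap[of i j] \<phi>(1) by (simp add: linear_neg)
  qed
  have "\<phi> ` e ` gens d = E ` gens d"
    using gen by (force simp: image_iff)
  moreover have "inj_on \<phi> (e ` gens d)"
    using gen frame_E[of d] by (auto simp: inj_on_def frame_def)
  ultimately have "inj_on \<phi> (span (e ` gens d))"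
    using linear_inj_on_span_iff_independent_image[OF \<phi>(1), of "e ` gens d"] frame_E[of d]
    by (simp add: frame_def)
  then show ?thesis
    using that[OF \<phi>(1) gen J] e'(2) by simp
qed

text \<open>The coordinate map respects brackets of basis vectors, hence all brackets by
  bilinearity, and it takes each distinguished span to the one on the same generators.\<close>

lemma iso_model:
  assumes e: "adapted_basis d T e" and c: "commutators d (bracket T) e c"
  obtains \<phi> where "triplet_iso \<phi> T (model c d)" "linear \<phi>" "\<And>a. a \<in> gens d \<Longrightarrow> \<phi> (e a) = E a"
proof -
  note e' = adapted_basisD[OF e]
  note L = lie_algebraD[OF e'(1)]
  let ?g = "algebra T" and ?br = "bracket T"
  obtain \<phi> where \<phi>: "linear \<phi>" and gen: "\<And>a. a \<in> gens d \<Longrightarrow> \<phi> (e a) = E a"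
    and J: "\<And>i j. i \<in> {1..d} \<Longrightarrow> j \<in> {1..d} \<Longrightarrow> \<phi> (e (genJ i j)) = E (genJ i j)"
    and inj: "inj_on \<phi> ?g"
    using coordinate_map[OF e] by metis
  have eg: "e a \<in> ?g" if "a \<in> gens d" for a
    using that e'(2) by (simp add: span_base)
  have image: "\<phi> ` span (e ` S) = span (E ` S)" if "S \<subseteq> gens d" for S
  proof -
    have "\<phi> ` e ` S = E ` S"
      using gen that by (force simp: image_iff)
    then show ?thesis
      using linear_span_image[OF \<phi>, of "e ` S"] by simp
  qed
  have \<phi>_simps: "\<phi> (x + y) = \<phi> x + \<phi> y" "\<phi> (x - y) = \<phi> x - \<phi> y" "\<phi> (- x) = - \<phi> x"
    "\<phi> (r *\<^sub>R x) = r *\<^sub>R \<phi> x" "\<phi> 0 = 0" for x y r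
    using \<phi> by (simp_all add: linear_add linear_diff linear_neg linear_scale linear_0)
  have amb: "ambient_aristotelian d ?g ?br e"
    using e by (simp add: adapted_basis_def)
  have ordered: "\<phi> (?br (e a) (e b)) = gen_bracket c a b"
    if ab: "a \<in> gens d" "b \<in> gens d" and "bracket_order a \<le> bracket_order b" for a b
  proof -
    have gens: "\<phi> (e genM) = E genM" "\<phi> (e genH) = E genH"
      "i \<in> {1..d} \<Longrightarrow> \<phi> (e (genP i)) = E (genP i)" "i \<in> {1..d} \<Longrightarrow> \<phi> (e (genK i)) = E (genK i)" for i
      using gen by (auto simp: gens_def)
    have KM: "?br (e (genK i)) (e genM) = - (mk_K c *\<^sub>R e (genK i) + mk_P c *\<^sub>R e (genP i))"
      if "i \<in> {1..d}" for i
      using that c lie_algebra_antisym[OF e'(1), of "e genM" "e (genK i)"]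
      by (simp add: commutatorsD(4)[OF c] eg gens_def)
    have self: "?br (e genM) (e genM) = 0" "?br (e genH) (e genH) = 0"
      using L(7) eg by (auto simp: gens_def)
    show ?thesis
      using that self
      by (cases a; cases b)
        (auto simp: gens_def commutatorsD[OF c] ambient_aristotelianD[OF amb] KM gens J \<phi>_simps)
  qed
  have gen_br: "\<phi> (?br (e a) (e b)) = gen_bracket c a b" if ab: "a \<in> gens d" "b \<in> gens d" for a b
  proof (cases "bracket_order a \<le> bracket_order b")
    case False
    then show ?thesis
      using ordered[of b a] that lie_algebra_antisym[OF e'(1), of "e b" "e a"]
        gen_bracket_antisym[of c a b] by (simp add: eg \<phi>_simps)
  qed (use ordered that in blast)
  \<comment> \<open>Extension from generators in the first slot. It is used twice, the second slot
    being reached through antisymmetry.\<close>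
  have left: "\<phi> (?br x y) = vec_bracket c (\<phi> x) (\<phi> y)"
    if x: "x \<in> span (e ` gens d)" and y: "y \<in> ?g"
      and "\<And>a. a \<in> gens d \<Longrightarrow> \<phi> (?br (e a) y) = vec_bracket c (E a) (\<phi> y)" for x y
  proof -
    have "x \<in> ?g \<and> \<phi> (?br x y) = vec_bracket c (\<phi> x) (\<phi> y)"
      using x
    proof (induction rule: span_induct_alt)
      case base
      show ?case
        using L(5)[OF subspace_0[OF L(1)] y, of 0] L(1)
        by (simp add: subspace_0 \<phi>_simps vec_bracket_bilinear_simps)
    next
      case (step r v w)
      then obtain a where a: "a \<in> gens d" "v = e a"
        by blast
      then show ?case
        using step that(3)[OF a(1)] y L(1)
        by (simp add: L(3,5) eg gen \<phi>_simps vec_bracket_bilinear_simps subspace_add subspace_scale)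
    qed
    then show ?thesis by blast
  qed
  have br: "\<phi> (?br x y) = vec_bracket c (\<phi> x) (\<phi> y)" if xy: "x \<in> ?g" "y \<in> ?g" for x y
  proof (rule left)
    fix a assume a: "a \<in> gens d"
    have "\<phi> (?br y (e a)) = vec_bracket c (\<phi> y) (\<phi> (e a))"
      using xy a e'(2) gen_br by (intro left) (auto simp: eg gen vec_bracket_E)
    then show "\<phi> (?br (e a) y) = vec_bracket c (E a) (\<phi> y)"
      using lie_algebra_antisym[OF e'(1) xy(2) eg[OF a]] vec_bracket_antisym[of c "\<phi> y" "E a"]
      by (simp add: gen a \<phi>_simps)
  qed (use xy e'(2) in auto)
  have "triplet_iso \<phi> T (model c d)"
    unfolding triplet_iso_def
  proof (intro conjI)
    show "bij_betw \<phi> ?g (algebra (model c d))"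
      using inj image[of "gens d"] e'(2) by (simp add: bij_betw_def model_def)
    show "\<forall>x\<in>?g. \<forall>y\<in>?g. \<phi> (?br x y) = bracket (model c d) (\<phi> x) (\<phi> y)"
      using br by simp
    show "\<phi> ` isotropy T = isotropy (model c d)" "\<phi> ` ideal_part T = ideal_part (model c d)"
      "\<phi> ` rotations T = rotations (model c d)" "\<phi> ` scalars T = scalars (model c d)"
      "\<phi> ` vectors T = vectors (model c d)"
      unfolding e'(6-10) by (subst image; force simp: model_def gens_def)+
  qed (simp_all add: \<phi>_simps)
  then show ?thesis
    using that \<phi> gen by blast
qed

section \<open>Composition and inversion of isomorphisms\<close>

lemma triplet_iso_trans:
  assumes "triplet_iso \<phi> T T'" "triplet_iso \<psi> T' T''"
  shows "triplet_iso (\<psi> \<circ> \<phi>) T T''"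
proof -
  have "\<phi> x \<in> algebra T'" if "x \<in> algebra T" for x
    using assms(1) that by (auto simp: triplet_iso_def bij_betw_def)
  then show ?thesis
    using assms unfolding triplet_iso_def image_comp[symmetric] by (auto intro: bij_betw_trans)
qed

text \<open>The adapted basis places all distinguished subspaces inside the algebra, where the
  inverse map cancels \<open>\<phi>\<close>.\<close>

lemma triplet_iso_sym:
  assumes \<phi>: "triplet_iso \<phi> T T'" and e: "adapted_basis d T e"
  shows "triplet_iso (inv_into (algebra T) \<phi>) T' T"
proof -
  let ?\<psi> = "inv_into (algebra T) \<phi>"
  note e' = adapted_basisD[OF e]
  note L = lie_algebraD[OF e'(1)]
  have inj: "inj_on \<phi> (algebra T)" and alg: "algebra T' = \<phi> ` algebra T"
    using \<phi> by (auto simp: triplet_iso_def bij_betw_def)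
  have hom: "\<phi> (x + y) = \<phi> x + \<phi> y" "\<phi> (r *\<^sub>R x) = r *\<^sub>R \<phi> x"
    "\<phi> (bracket T x y) = bracket T' (\<phi> x) (\<phi> y)" if "x \<in> algebra T" "y \<in> algebra T" for x y r
    using \<phi> that by (auto simp: triplet_iso_def)
  have sub: "isotropy T \<subseteq> algebra T" "ideal_part T \<subseteq> algebra T" "rotations T \<subseteq> algebra T"
    "scalars T \<subseteq> algebra T" "vectors T \<subseteq> algebra T"
    unfolding e'(2,6-10) by (intro span_mono image_mono; force simp: gens_def)+
  have parts: "\<phi> ` isotropy T = isotropy T'" "\<phi> ` ideal_part T = ideal_part T'"
    "\<phi> ` rotations T = rotations T'" "\<phi> ` scalars T = scalars T'" "\<phi> ` vectors T = vectors T'"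
    using \<phi> by (auto simp: triplet_iso_def)
  have inv: "?\<psi> (\<phi> x) = x" if "x \<in> algebra T" for x
    using that inj by simp
  show ?thesis
    unfolding triplet_iso_def
  proof (intro conjI)
    show "bij_betw ?\<psi> (algebra T') (algebra T)"
      using \<phi> by (auto simp: triplet_iso_def intro: bij_betw_inv_into)
    show "\<forall>x\<in>algebra T'. \<forall>y\<in>algebra T'. ?\<psi> (x + y) = ?\<psi> x + ?\<psi> y"
      unfolding alg using L(1) by (auto simp: inv subspace_add simp flip: hom)
    show "\<forall>r. \<forall>x\<in>algebra T'. ?\<psi> (r *\<^sub>R x) = r *\<^sub>R ?\<psi> x"
      unfolding alg using L(1) by (auto simp: inv subspace_scale simp flip: hom)
    show "\<forall>x\<in>algebra T'. \<forall>y\<in>algebra T'. ?\<psi> (bracket T' x y) = bracket T (?\<psi> x) (?\<psi> y)"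
      unfolding alg using L(2) by (auto simp: inv simp flip: hom)
    show "?\<psi> ` isotropy T' = isotropy T" "?\<psi> ` ideal_part T' = ideal_part T"
      "?\<psi> ` rotations T' = rotations T" "?\<psi> ` scalars T' = scalars T" "?\<psi> ` vectors T' = vectors T"
      unfolding parts[symmetric] by (intro inv_into_image_cancel[OF inj] sub)+
  qed
qed

subsection \<open>Necessary conditions on the coefficients\<close>

lemma triplet_iso_bracket:
  assumes "triplet_iso \<phi> T (model c d)" "x \<in> algebra T" "y \<in> algebra T"
  shows "\<phi> (bracket T x y) = vec_bracket c (\<phi> x) (\<phi> y)"
  using assms by (simp add: triplet_iso_def)

text \<open>The Jacobi identity of \<open>T\<close> is carried into coordinates, where it becomes a
  system of equations between the coefficients.\<close>

lemma jacobiator_coeffs: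
  assumes e: "adapted_basis d T e" and c: "commutators d (bracket T) e c"
    and xyz: "x \<in> gens d" "y \<in> gens d" "z \<in> gens d"
  shows "jacobiator c (E x) (E y) (E z) = 0"
proof -
  note e' = adapted_basisD[OF e]
  note L = lie_algebraD[OF e'(1)]
  obtain \<phi> where \<phi>: "triplet_iso \<phi> T (model c d)" "linear \<phi>" "\<And>a. a \<in> gens d \<Longrightarrow> \<phi> (e a) = E a"
    using iso_model[OF e c] by blast
  have eg: "e a \<in> algebra T" if "a \<in> gens d" for a
    using that e'(2) by (simp add: span_base)
  have "\<phi> (bracket T (e x) (bracket T (e y) (e z)) + bracket T (e y) (bracket T (e z) (e x))
      + bracket T (e z) (bracket T (e x) (e y))) = 0"
    using L(8) eg xyz \<phi>(2) by (simp add: linear_0)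
  then show ?thesis
    using xyz \<phi>(2)
    by (simp add: jacobiator_def linear_add triplet_iso_bracket[OF \<phi>(1)] L(2) eg \<phi>(3))
qed

text \<open>Bracketing \<open>M\<close> with \<open>H\<close>, \<open>K\<close> and \<open>P\<close>
  must give multiples of \<open>M\<close>; since \<open>1 \<le> d\<close>, the vectors with index
  \<open>1\<close> are available.\<close>

lemma ideal_coeffs:
  assumes e: "adapted_basis d T e" and c: "commutators d (bracket T) e c" and d: "1 \<le> d"
    and i: "lie_ideal (lie_space_of (algebra T) (bracket T)) (ideal_part T)"
  shows "hm_H c = 0" "mk_K c = 0" "mk_P c = 0" "mp_K c = 0" "mp_P c = 0"
proof -
  note e' = adapted_basisD[OF e]
  obtain \<phi> where \<phi>: "triplet_iso \<phi> T (model c d)" "linear \<phi>" "\<And>a. a \<in> gens d \<Longrightarrow> \<phi> (e a) = E a"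
    using iso_model[OF e c] by blast
  have gens: "genM \<in> gens d" "genH \<in> gens d" "genK 1 \<in> gens d" "genP 1 \<in> gens d"
    using d by (auto simp: gens_def)
  have "gen_bracket c a genM \<in> span {E genM}" if a: "a \<in> gens d" for a
  proof -
    have g: "e a \<in> algebra T" "e genM \<in> algebra T"
      using a gens e'(2) by (simp_all add: span_base)
    moreover have "e genM \<in> ideal_part T"
      using e'(10) by (simp add: span_base)
    ultimately have "bracket T (e a) (e genM) \<in> ideal_part T"
      using i by (simp add: lie_ideal_def lie_space_of_def)
    then have "\<phi> (bracket T (e a) (e genM)) \<in> \<phi> ` ideal_part T"
      by blast
    then show ?thesis
      using \<phi> g a gens triplet_iso_bracket[OF \<phi>(1) g]
      by (simp add: triplet_iso_def model_def vec_bracket_E)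
  qed
  then have "Poly_Mapping.lookup (gen_bracket c a genM) b = 0" if "a \<in> gens d" "b \<noteq> genM" for a b
    using that lookup_eq_zero[of "gen_bracket c a genM" "{genM}" b] by (simp add: mem_ideal_iff)
  from this[of genH genH] this[of "genK 1" "genK 1"] this[of "genK 1" "genP 1"]
    this[of "genP 1" "genK 1"] this[of "genP 1" "genP 1"]
  show "hm_H c = 0" "mk_K c = 0" "mk_P c = 0" "mp_K c = 0" "mp_P c = 0"
    using gens by (simp_all add: lookup_add lookup_minus)
qed

text \<open>For \<open>d = 1\<close> the isotropy is the line of \<open>K\<^sub>1\<close>; if both coefficients below vanish, it becomes an
  ideal of the quotient by \<open>M\<close>.\<close>

lemma effective_coeffs:
  assumes e: "adapted_basis 1 T e" and c: "commutators 1 (bracket T) e c"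
    and i: "lie_ideal (lie_space_of (algebra T) (bracket T)) (ideal_part T)"
    and eff: "effective (quotient_lie (algebra T) (bracket T) (ideal_part T))
      (coset (ideal_part T) ` isotropy T)"
  shows "kp_H c \<noteq> 0 \<or> kh_P c \<noteq> 0"
proof (rule ccontr)
  assume zero: "\<not> (kp_H c \<noteq> 0 \<or> kh_P c \<noteq> 0)"
  note e' = adapted_basisD[OF e]
  note L = lie_algebraD[OF e'(1)]
  let ?i = "ideal_part T" and ?h = "isotropy T" and ?g = "algebra T" and ?br = "bracket T"
  obtain \<phi> where \<phi>: "triplet_iso \<phi> T (model c 1)" "linear \<phi>" "\<And>a. a \<in> gens 1 \<Longrightarrow> \<phi> (e a) = E a"
    using iso_model[OF e c] by blast
  have gens: "gens 1 = {genM, genH, genK 1, genP 1}"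
    by (auto simp: gens_def)
  have \<phi>e: "\<phi> (e genM) = E genM" "\<phi> (e (genK 1)) = E (genK 1)"
    by (auto intro!: \<phi>(3) simp: gens_def)
  have sub: "subspace ?i" "subspace ?h" "?i \<subseteq> ?g" "?h \<subseteq> ?g"
    unfolding e'(2,9,10) by (auto simp: gens_def intro!: span_mono)
  have h: "?h = span {e (genK 1)}"
    unfolding e'(9) by (rule arg_cong[where f = span]) auto
  have ideal: "?br x y \<in> ?i" if "x \<in> ?g" "y \<in> ?i" for x y
    using i that by (simp add: lie_ideal_def lie_space_of_def)
  have br: "\<exists>z\<in>?h. ?br x y - z \<in> ?i" if x: "x \<in> ?g" and y: "y \<in> ?h" for x y
  proof -
    have "\<phi> ` ?h = span (E ` {genK 1})"
      unfolding h using linear_span_image[OF \<phi>(2), of "{e (genK 1)}"] \<phi>e by simp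
    then have "\<phi> x \<in> span (E ` gens 1)" "\<phi> y \<in> span (E ` {genK 1})"
      using \<phi>(1) x y by (auto simp: triplet_iso_def model_def bij_betw_def)
    \<comment> \<open>With both coefficients zero, \<open>[K, H]\<close> is a multiple of
      \<open>K\<close> and \<open>[K, P]\<close> a multiple of \<open>M\<close>, the rotation
      \<open>genJ 1 1\<close> being zero.\<close>
    then have "vec_bracket c (\<phi> x) (\<phi> y) \<in> span {E (genK 1), E genM}"
    proof (rule vec_bracket_mem_subspace)
      fix a b assume "a \<in> gens 1" "b \<in> {genK 1}"
      then show "gen_bracket c a b \<in> span {E (genK 1), E genM}"
        using zero ideal_coeffs[OF e c order_refl i] unfolding gens
        by (auto simp: E_genJ_refl span_neg span_scale span_zero span_base)
    qed simp
    moreover have "span {E (genK 1), E genM} = \<phi> ` span {e (genK 1), e genM}"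
      using linear_span_image[OF \<phi>(2), of "{e (genK 1), e genM}"] \<phi>e by simp
    ultimately obtain w where w: "w \<in> span {e (genK 1), e genM}" "\<phi> (?br x y) = \<phi> w"
      using triplet_iso_bracket[OF \<phi>(1) x, of y] y sub(4) by auto
    have "span {e (genK 1), e genM} \<subseteq> ?g"
      unfolding e'(2) gens by (intro span_mono) auto
    then have "?br x y = w"
      using w \<phi>(1) L(2)[OF x, of y] y sub(4)
      by (auto simp: triplet_iso_def bij_betw_def dest: inj_onD)
    moreover obtain k where "w - k *\<^sub>R e (genK 1) \<in> span {e genM}"
      using w(1) span_breakdown_eq[of w] by blast
    ultimately show ?thesis
      using h e'(10) by (intro bexI[of _ "k *\<^sub>R e (genK 1)"]) (auto simp: span_scale span_base)
  qed
  have "lie_ideal (quotient_lie ?g ?br ?i) (coset ?i ` ?h)"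
    unfolding lie_ideal_def quotient_lie_simps
  proof (intro conjI ballI allI)
    show "coset ?i ` ?h \<subseteq> coset ?i ` ?g"
      using sub by blast
    show "?i \<in> coset ?i ` ?h"
      using subspace_0[OF sub(2)] coset_zero[of ?i] by (metis imageI)
  next
    fix A B assume "A \<in> coset ?i ` ?h" "B \<in> coset ?i ` ?h"
    then show "{a + b | a b. a \<in> A \<and> b \<in> B} \<in> coset ?i ` ?h"
      using sub by (auto simp: coset_plus intro!: imageI subspace_add)
  next
    fix r A assume "A \<in> coset ?i ` ?h"
    then show "(\<Union>a\<in>A. coset ?i (r *\<^sub>R a)) \<in> coset ?i ` ?h"
      using sub by (auto simp: coset_scale intro!: imageI subspace_scale)
  next
    fix A B assume "A \<in> coset ?i ` ?g" "B \<in> coset ?i ` ?h"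
    then obtain x y where xy: "x \<in> ?g" "y \<in> ?h" "A = coset ?i x" "B = coset ?i y"
      by blast
    then obtain z where "z \<in> ?h" "?br x y - z \<in> ?i"
      using br by blast
    then have "z \<in> ?h" "coset ?i (?br x y) = coset ?i z"
      by (simp_all add: coset_eq_iff sub)
    moreover have "(\<Union>a\<in>A. \<Union>b\<in>B. coset ?i (?br a b)) = coset ?i (?br x y)"
      unfolding xy(3,4) using xy sub ideal by (intro coset_bracket[OF e'(1)]) auto
    ultimately show "(\<Union>a\<in>A. \<Union>b\<in>B. coset ?i (?br a b)) \<in> coset ?i ` ?h"
      by blast
  qed
  \<comment> \<open>Effectivity collapses the image of the isotropy, forcing the non-zero vector
    \<open>K\<close> into the line of \<open>M\<close>.\<close>
  then have "coset ?i ` ?h = {?i}"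
    using eff unfolding effective_def quotient_lie_simps by blast
  moreover have "e (genK 1) \<in> ?h"
    unfolding h by (simp add: span_base)
  ultimately have "coset ?i (e (genK 1)) = coset ?i 0"
    unfolding coset_zero by blast
  then have "e (genK 1) \<in> ?i"
    by (simp add: coset_eq_iff sub)
  then have "\<phi> (e (genK 1)) \<in> span {E genM}"
    using \<phi>(1) by (auto simp: triplet_iso_def model_def)
  then show False
    using \<phi>e lookup_eq_zero[of "E (genK 1)" "{genM}" "genK 1"] by (simp add: mem_ideal_iff)
qed

text \<open>The same coefficients occur for all \<open>d\<close>, so conditions from different
  dimensions combine: \<open>d = 1\<close> gives those of the ideal and of effectivity,
  \<open>d = 2\<close> the Jacobi relations.\<close>

lemma admissible_coeffs:
  assumes T: "\<And>d. d \<ge> 1 \<Longrightarrow> projectable_triplet d (T d)"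
    and c: "\<And>d. d \<ge> 1 \<Longrightarrow> \<exists>e. adapted_basis d (T d) e \<and> commutators d (bracket (T d)) e c"
  shows "admissible c"
proof -
  have ideal: "lie_ideal (lie_space_of (algebra (T d)) (bracket (T d))) (ideal_part (T d))"
    if "d \<ge> 1" for d
    using T[OF that] by (simp add: projectable_triplet_def)
  obtain e where e: "adapted_basis 1 (T 1) e" "commutators 1 (bracket (T 1)) e c"
    using c by blast
  have c0: "hm_H c = 0" "mk_K c = 0" "mk_P c = 0" "mp_K c = 0" "mp_P c = 0"
    using ideal_coeffs[OF e order_refl ideal] by auto
  have eff: "kp_H c \<noteq> 0 \<or> kh_P c \<noteq> 0"
    using effective_coeffs[OF e ideal] T[of 1] by (simp add: projectable_triplet_def)
  \<comment> \<open>Dimension two is the smallest with a non-zero rotation, so that its coefficients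
    become visible.\<close>
  obtain e where e: "adapted_basis 2 (T 2) e" "commutators 2 (bracket (T 2)) e c"
    using c[of 2] by auto
  have J: "Poly_Mapping.lookup (jacobiator c (E x) (E y) (E z)) b = 0"
    if "x \<in> gens 2" "y \<in> gens 2" "z \<in> gens 2" for x y z b
    using jacobiator_coeffs[OF e that] by simp
  have gens: "genM \<in> gens 2" "genH \<in> gens 2" "genK 1 \<in> gens 2" "genP 1 \<in> gens 2"
    "genK 2 \<in> gens 2" "genP 2 \<in> gens 2"
    by (auto simp: gens_def)
  note simps = jacobiator_def vec_bracket_E vec_bracket_bilinear_simps c0 gens lookup_add lookup_minus
    E_genJ_refl
  \<comment> \<open>The triples with index \<open>1\<close> only relate the scalar and vector
    coefficients; \<open>(K 1, K 2, P 2)\<close> and \<open>(P 1, P 2, K 2)\<close> determine the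
    rotation coefficients.\<close>
  have "kp_H c * hm_M c = 0"
    using J[OF gens(3) gens(4) gens(1), of genM] by (simp add: simps)
  moreover have "kp_H c * (hp_P c - kh_K c) = 0"
    using J[OF gens(2) gens(3) gens(4), of genH] by (auto simp: simps algebra_simps)
  moreover have "kp_M c * (hm_M c - hp_P c + kh_K c) = 0"
    using J[OF gens(2) gens(3) gens(4), of genM] by (simp add: simps algebra_simps)
  moreover have "kk_J c = kp_H c * kh_P c"
    using J[OF gens(3) gens(5) gens(6), of "genP 1"] by (simp add: simps algebra_simps)
  moreover have "kp_J c = - kp_H c * kh_K c"
    using J[OF gens(3) gens(5) gens(6), of "genK 1"] by (simp add: simps algebra_simps)
  moreover have "pp_J c = kp_H c * hp_K c"
    using J[OF gens(4) gens(6) gens(5), of "genK 1"] by (simp add: simps algebra_simps)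
  ultimately show ?thesis
    using c0 eff unfolding admissible_def by blast
qed

subsection \<open>Normal forms\<close>

text \<open>How the coefficients change under \<open>K' = \<kappa> K\<close>, \<open>P' = \<pi> P + \<rho> K\<close>, \<open>H' = \<eta> H + \<tau> M\<close>,
  \<open>M' = \<mu> M\<close>. Those of the rotations are left out: admissibility determines them.\<close>

definition coeff_change ::
  "real \<Rightarrow> real \<Rightarrow> real \<Rightarrow> real \<Rightarrow> real \<Rightarrow> real \<Rightarrow> coeffs \<Rightarrow> coeffs \<Rightarrow> bool" where
  "coeff_change \<kappa> \<pi> \<rho> \<eta> \<tau> \<mu> c c' \<longleftrightarrow>
     hm_M c' = \<eta> * hm_M c \<and>
     kh_P c' * \<pi> = \<kappa> * \<eta> * kh_P c \<and>
     kh_K c' * \<kappa> + kh_P c' * \<rho> = \<kappa> * \<eta> * kh_K c \<and>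
     hp_P c' * \<pi> = \<eta> * \<pi> * hp_P c - \<eta> * \<rho> * kh_P c \<and>
     hp_K c' * \<kappa> + hp_P c' * \<rho> = \<eta> * \<pi> * hp_K c - \<eta> * \<rho> * kh_K c \<and>
     kp_H c' * \<eta> = \<kappa> * \<pi> * kp_H c \<and>
     kp_H c' * \<tau> + kp_M c' * \<mu> = \<kappa> * \<pi> * kp_M c"

text \<open>Chooses one representative in each orbit of \<open>(\<epsilon>, \<omega>, l)\<close>
  under \<open>(\<eta>\<^sup>2 * \<epsilon>, \<eta> * \<omega>, \<eta> * l)\<close> with
  \<open>\<eta> \<noteq> 0\<close>, the effect of rescaling \<open>H\<close>. The bargmannian family
  is the case \<open>l = \<omega>\<close>.\<close>

definition normal_params :: "real \<Rightarrow> real \<Rightarrow> real \<Rightarrow> bool" where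
  "normal_params \<epsilon> \<omega> l \<longleftrightarrow>
     \<epsilon> = 0 \<and> \<omega> = 0 \<and> (l = 0 \<or> l = 1) \<or> \<epsilon> = 0 \<and> \<omega> = 1 \<or>
     \<bar>\<epsilon>\<bar> = 1 \<and> (\<omega> > 0 \<or> \<omega> = 0 \<and> l \<ge> 0)"

lemma g_ambient_family_iff:
  "c \<in> g_ambient_family \<longleftrightarrow> (\<exists>\<epsilon> \<omega> l. normal_params \<epsilon> \<omega> l \<and> c = g_ambient_coeffs \<epsilon> \<omega> l)"
proof -
  have "\<bar>\<epsilon>\<bar> = 1 \<longleftrightarrow> \<epsilon> = 1 \<or> \<epsilon> = -1" for \<epsilon> :: real by auto
  then show ?thesis
    unfolding g_ambient_family_def normal_params_def by auto
qed

lemma bargmann_family_iff: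
  "c \<in> bargmann_family \<longleftrightarrow> (\<exists>\<epsilon> \<omega>. normal_params \<epsilon> \<omega> \<omega> \<and> c = bargmann_coeffs \<epsilon> \<omega>)"
proof -
  have "\<bar>\<epsilon>\<bar> = 1 \<longleftrightarrow> \<epsilon> = 1 \<or> \<epsilon> = -1" for \<epsilon> :: real by auto
  then show ?thesis
    unfolding bargmann_family_def normal_params_def by auto
qed

text \<open>Carrollian, riemannian and lorentzian triplets in one formula, for \<open>s\<close>
  equal to \<open>0\<close>, \<open>-1\<close> and \<open>1\<close>.\<close>

definition metric_coeffs :: "real \<Rightarrow> real \<Rightarrow> coeffs" where
  "metric_coeffs s q = no_coeffs\<lparr>kk_J := s, kp_H := 1, kh_P := s, hp_K := q, pp_J := q\<rparr>"

text \<open>The carrollian member outside the previous scheme, distinguished by a \<open>K\<close>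
  component in \<open>[K, H]\<close>.\<close>

definition light_cone_coeffs :: coeffs where
  "light_cone_coeffs = no_coeffs\<lparr>kp_H := 1, kp_J := 1, hp_P := -1, kh_K := -1\<rparr>"

lemma metric_families_iff:
  "c \<in> carroll_family \<union> riemann_family \<union> lorentz_family \<longleftrightarrow>
    c = light_cone_coeffs \<or> (\<exists>s\<in>{0, -1, 1}. \<exists>q\<in>{0, -1, 1}. c = metric_coeffs s q)"
proof -
  have "riemann_family = metric_coeffs (-1) ` {0, -1, 1}" "lorentz_family = metric_coeffs 1 ` {0, -1, 1}"
    unfolding riemann_family_def lorentz_family_def metric_coeffs_def by (rule Setcompr_eq_image)+
  moreover have "carroll_family = insert light_cone_coeffs (metric_coeffs 0 ` {0, -1, 1})"
    unfolding carroll_family_def metric_coeffs_def light_cone_coeffs_def no_coeffs_def by simp blast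
  ultimately show ?thesis
    by blast
qed

lemma triplet_list_iff:
  "c \<in> triplet_list \<longleftrightarrow>
    (\<exists>\<epsilon> \<omega> l. normal_params \<epsilon> \<omega> l \<and> c = g_ambient_coeffs \<epsilon> \<omega> l) \<or>
    (\<exists>\<epsilon> \<omega>. normal_params \<epsilon> \<omega> \<omega> \<and> c = bargmann_coeffs \<epsilon> \<omega>) \<or>
    c = light_cone_coeffs \<or> (\<exists>s\<in>{0, -1, 1}. \<exists>q\<in>{0, -1, 1}. c = metric_coeffs s q)"
proof -
  have "c \<in> triplet_list \<longleftrightarrow> c \<in> g_ambient_family \<or> c \<in> bargmann_family \<or>
      c \<in> carroll_family \<union> riemann_family \<union> lorentz_family"
    unfolding triplet_list_def by blast
  then show ?thesis
    by (simp only: g_ambient_family_iff bargmann_family_iff metric_families_iff)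
qed

section \<open>Reduction to normal form\<close>

lemma rescale_to_sign:
  fixes x :: real
  obtains r where "r > 0" "r\<^sup>2 * x = sgn x"
proof (cases "x = 0")
  case True
  then show ?thesis using that[of 1] by simp
next
  case False
  then have "(1 / sqrt \<bar>x\<bar>)\<^sup>2 * x = sgn x"
    by (simp add: power_divide sgn_if)
  then show ?thesis using False that[of "1 / sqrt \<bar>x\<bar>"] by simp
qed

lemma ex_normal_params: "\<exists>\<eta>. \<eta> \<noteq> 0 \<and> normal_params (\<eta>\<^sup>2 * \<epsilon>) (\<eta> * \<omega>) (\<eta> * l)"
proof -
  consider "\<epsilon> \<noteq> 0" | "\<epsilon> = 0" "\<omega> \<noteq> 0" | "\<epsilon> = 0" "\<omega> = 0" "l \<noteq> 0" | "\<epsilon> = 0" "\<omega> = 0" "l = 0"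
    by blast
  then show ?thesis
  proof cases
    case 1
    obtain r where r: "r > 0" "r\<^sup>2 * \<epsilon> = sgn \<epsilon>"
      using rescale_to_sign by blast
    \<comment> \<open>The factor \<open>r\<close> fixes the size of \<open>\<epsilon>\<close>; the
      sign of the scaling is still free and is spent on \<open>\<omega>\<close>, or on
      \<open>l\<close> when \<open>\<omega>\<close> vanishes.\<close>
    define s :: real where "s = (if \<omega> > 0 \<or> \<omega> = 0 \<and> l \<ge> 0 then 1 else -1)"
    have "s\<^sup>2 = 1" "s \<noteq> 0" "s * \<omega> > 0 \<or> s * \<omega> = 0 \<and> s * l \<ge> 0"
      by (auto simp: s_def)
    then have "s * r \<noteq> 0" "(s * r)\<^sup>2 * \<epsilon> = sgn \<epsilon>"
      "(s * r) * \<omega> > 0 \<or> (s * r) * \<omega> = 0 \<and> (s * r) * l \<ge> 0"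
      using r by (auto simp: power_mult_distrib mult.assoc mult.left_commute[of s r] zero_less_mult_iff
          zero_le_mult_iff)
    moreover have "\<bar>sgn \<epsilon>\<bar> = 1"
      using 1 by simp
    ultimately show ?thesis
      unfolding normal_params_def by metis
  next
    case 2
    then show ?thesis
      by (intro exI[of _ "1 / \<omega>"]) (simp add: normal_params_def)
  next
    case 3
    then show ?thesis
      by (intro exI[of _ "1 / l"]) (simp add: normal_params_def)
  next
    case 4
    then show ?thesis
      by (intro exI[of _ 1]) (simp add: normal_params_def)
  qed
qed

text \<open>If \<open>\<epsilon>\<close> is non-zero, its size forces \<open>\<eta>\<close> to be
  \<open>1\<close> or \<open>-1\<close> and the sign conditions do the rest. Otherwise
  \<open>\<eta>\<close> is \<open>1\<close> as soon as \<open>\<omega>\<close> or \<open>l\<close>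
  is non-zero.\<close>

lemma normal_params_unique:
  assumes "normal_params \<epsilon> \<omega> l" "normal_params (\<eta>\<^sup>2 * \<epsilon>) (\<eta> * \<omega>) (\<eta> * l)" "\<eta> \<noteq> 0"
  shows "\<eta>\<^sup>2 * \<epsilon> = \<epsilon>" "\<eta> * \<omega> = \<omega>" "\<eta> * l = l"
proof -
  have "\<eta>\<^sup>2 * \<epsilon> = \<epsilon> \<and> \<eta> * \<omega> = \<omega> \<and> \<eta> * l = l"
  proof (cases "\<epsilon> = 0")
    case True
    then show ?thesis
      using assms by (auto simp: normal_params_def)
  next
    case False
    then have "\<bar>\<epsilon>\<bar> = 1" "\<bar>\<eta>\<^sup>2 * \<epsilon>\<bar> = 1"
      using assms by (auto simp: normal_params_def)
    then have "\<eta>\<^sup>2 = 1"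
      by (simp add: abs_mult)
    then have "\<eta> = 1 \<or> \<eta> = -1"
      by (simp add: power2_eq_1_iff)
    then show ?thesis
      using assms False by (auto simp: normal_params_def)
  qed
  then show "\<eta>\<^sup>2 * \<epsilon> = \<epsilon>" "\<eta> * \<omega> = \<omega>" "\<eta> * l = l"
    by auto
qed

lemma ex_coeff_change:
  assumes adm: "admissible c"
  obtains \<kappa> \<pi> \<rho> \<eta> \<tau> \<mu> c' where "\<kappa> \<noteq> 0" "\<pi> \<noteq> 0" "\<eta> \<noteq> 0" "\<mu> \<noteq> 0" "c' \<in> triplet_list"
    "coeff_change \<kappa> \<pi> \<rho> \<eta> \<tau> \<mu> c c'"
proof -
  let ?a = "kp_H c" and ?b = "kp_M c" and ?k = "kh_K c" and ?p = "kh_P c"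
    and ?q = "hp_K c" and ?r = "hp_P c" and ?l = "hm_M c"
  have rel: "?a * ?l = 0" "?a * (?r - ?k) = 0" "?b * (?l - ?r + ?k) = 0" "?a \<noteq> 0 \<or> ?p \<noteq> 0"
    using adm by (auto simp: admissible_def)
  note list = triplet_list_iff[THEN iffD2]
  note defs = coeff_change_def g_ambient_coeffs_def bargmann_coeffs_def metric_coeffs_def
    light_cone_coeffs_def no_coeffs_def
  consider "?a = 0" "?b = 0" | "?a = 0" "?b \<noteq> 0" | "?a \<noteq> 0" "?p \<noteq> 0"
    | "?a \<noteq> 0" "?p = 0" "?k \<noteq> 0" | "?a \<noteq> 0" "?p = 0" "?k = 0"
    by blast
  then show ?thesis
  proof cases
    case 1
    \<comment> \<open>The first two parameters are the determinant and trace of the adjoint action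
      of the rescaled \<open>H\<close> on the span of \<open>K\<close> and \<open>P\<close>; taking
      \<open>[K, H]\<close> as the new \<open>P\<close> puts this action in companion form.\<close>
    obtain \<eta> where \<eta>: "\<eta> \<noteq> 0" "normal_params (\<eta>\<^sup>2 * (?p * ?q - ?r * ?k)) (\<eta> * (?r - ?k)) (\<eta> * ?l)"
      using ex_normal_params by blast
    show ?thesis
    proof (rule that)
      show "g_ambient_coeffs (\<eta>\<^sup>2 * (?p * ?q - ?r * ?k)) (\<eta> * (?r - ?k)) (\<eta> * ?l) \<in> triplet_list"
        using \<eta> by (intro list) blast
      show "coeff_change 1 (\<eta> * ?p) (\<eta> * ?k) \<eta> 0 1 c
        (g_ambient_coeffs (\<eta>\<^sup>2 * (?p * ?q - ?r * ?k)) (\<eta> * (?r - ?k)) (\<eta> * ?l))"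
        using 1 by (simp add: defs algebra_simps power2_eq_square)
    qed (use \<eta> rel 1 in auto)
  next
    case 2
    then have l: "?l = ?r - ?k"
      using rel by auto
    \<comment> \<open>As before, but now \<open>?l\<close> equals the trace. The new
      \<open>M\<close> is the bracket of \<open>K\<close> with the new \<open>P\<close>, which
      explains the factor \<open>\<eta> * ?p * ?b\<close> below.\<close>
    obtain \<eta> where \<eta>: "\<eta> \<noteq> 0" "normal_params (\<eta>\<^sup>2 * (?p * ?q - ?r * ?k)) (\<eta> * (?r - ?k)) (\<eta> * (?r - ?k))"
      using ex_normal_params by blast
    show ?thesis
    proof (rule that)
      show "bargmann_coeffs (\<eta>\<^sup>2 * (?p * ?q - ?r * ?k)) (\<eta> * (?r - ?k)) \<in> triplet_list"
        using \<eta> by (intro list) blast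
      show "coeff_change 1 (\<eta> * ?p) (\<eta> * ?k) \<eta> 0 (\<eta> * ?p * ?b) c
        (bargmann_coeffs (\<eta>\<^sup>2 * (?p * ?q - ?r * ?k)) (\<eta> * (?r - ?k)))"
        using 2 by (simp add: defs l algebra_simps power2_eq_square)
    qed (use \<eta> rel 2 in auto)
  next
    case 3
    then have r: "?r = ?k" "?l = 0"
      using rel by auto
    obtain \<kappa> where \<kappa>: "\<kappa> > 0" "\<kappa>\<^sup>2 * (?a * ?p) = sgn (?a * ?p)"
      using rescale_to_sign by blast
    \<comment> \<open>The new \<open>H\<close> is the scalar part of \<open>[K', P']\<close>, and
      adding \<open>?k / ?p\<close> times \<open>K\<close> to \<open>P\<close> removes the
      \<open>K\<close> component of \<open>[K, H]\<close>. Then \<open>Q\<close> is the coefficient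
      of \<open>K\<close> in \<open>[H, P]\<close> before \<open>P\<close> is rescaled by
      \<open>\<pi>\<close>.\<close>
    define Q where "Q = ?a * (?q - ?k\<^sup>2 / ?p)"
    obtain \<pi> where \<pi>: "\<pi> > 0" "\<pi>\<^sup>2 * Q = sgn Q"
      using rescale_to_sign by blast
    show ?thesis
    proof (rule that)
      have "sgn (?a * ?p) \<in> {0, -1, 1}" "sgn Q \<in> {0, -1, 1}"
        unfolding sgn_if by auto
      then show "metric_coeffs (sgn (?a * ?p)) (sgn Q) \<in> triplet_list"
        by (intro list) blast
      show "coeff_change \<kappa> \<pi> (\<pi> * ?k / ?p) (\<kappa> * \<pi> * ?a) (\<kappa> * \<pi> * ?b) 1 c
        (metric_coeffs (sgn (?a * ?p)) (sgn Q))"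
        unfolding \<kappa>(2)[symmetric] \<pi>(2)[symmetric]
        using 3 r by (simp add: Q_def defs field_simps power2_eq_square)
    qed (use \<kappa> \<pi> 3 in auto)
  next
    case 4
    then have r: "?r = ?k" "?l = 0"
      using rel by auto
    show ?thesis
    proof (rule that)
      show "light_cone_coeffs \<in> triplet_list"
        by (intro list) blast
      \<comment> \<open>\<open>H\<close> acts on \<open>K\<close> and \<open>P\<close> with
        eigenvalues \<open>- ?k\<close> and \<open>?k\<close>; the multiple of \<open>K\<close>,
        with its factor \<open>2\<close>, turns \<open>P\<close> into an eigenvector. The other
        scalings give \<open>[K, H] = - K\<close> and the scalar part of \<open>[K, P]\<close> equal
        to \<open>H\<close>.\<close>
      show "coeff_change 1 (- 1 / (?a * ?k)) (- ?q / (2 * ?a * ?k\<^sup>2)) (- 1 / ?k) (- ?b / (?a * ?k)) 1 c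
        light_cone_coeffs"
        using 4 r by (simp add: defs field_simps power2_eq_square)
    qed (use 4 in auto)
  next
    case 5
    then have r: "?r = 0" "?l = 0"
      using rel by auto
    obtain \<pi> where \<pi>: "\<pi> > 0" "\<pi>\<^sup>2 * (?a * ?q) = sgn (?a * ?q)"
      using rescale_to_sign by blast
    show ?thesis
    proof (rule that)
      have "sgn (?a * ?q) \<in> {0, -1, 1}"
        unfolding sgn_if by auto
      then show "metric_coeffs 0 (sgn (?a * ?q)) \<in> triplet_list"
        by (intro list) blast
      show "coeff_change 1 \<pi> 0 (\<pi> * ?a) (\<pi> * ?b) 1 c (metric_coeffs 0 (sgn (?a * ?q)))"
        unfolding \<pi>(2)[symmetric] using 5 r by (simp add: defs field_simps power2_eq_square)
    qed (use \<pi> 5 in auto)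
  qed
qed

text \<open>Patterns of vanishing coefficients separate the families; inside a family the change
  acts by a scaling whose orbits meet the list only once.\<close>

lemma coeff_change_unique:
  assumes c: "c \<in> triplet_list" and c': "c' \<in> triplet_list"
    and change: "coeff_change \<kappa> \<pi> \<rho> \<eta> \<tau> \<mu> c c'" and nz: "\<kappa> \<noteq> 0" "\<pi> \<noteq> 0" "\<eta> \<noteq> 0" "\<mu> \<noteq> 0"
  shows "c = c'"
proof -
  note defs = g_ambient_coeffs_def bargmann_coeffs_def metric_coeffs_def
    light_cone_coeffs_def no_coeffs_def
  note eqs = change[unfolded coeff_change_def]
  have sign: "s = s'" if "s \<in> {0, -1, 1}" "s' \<in> {0, -1, 1}" "s' = x\<^sup>2 * s" "x \<noteq> 0"
    for s s' x :: real
  proof -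
    have "s = sgn s" "s' = sgn s'"
      using that(1,2) by auto
    moreover have "x\<^sup>2 > 0"
      using that(4) by simp
    then have "sgn s' = sgn s"
      unfolding that(3) by (auto simp: sgn_if zero_less_mult_iff)
    ultimately show ?thesis by simp
  qed
  \<comment> \<open>The first two patterns are preserved by every change. The \<open>M\<close> part
    of \<open>[K, P]\<close> and the \<open>K\<close> part of \<open>[K, H]\<close> are comparable
    only once the \<open>H\<close> part, respectively the \<open>P\<close> part, is zero.\<close>
  have zero: "kp_H c' = 0 \<longleftrightarrow> kp_H c = 0" "kh_P c' = 0 \<longleftrightarrow> kh_P c = 0"
    using eqs nz by auto
  have "kp_H c = 0 \<Longrightarrow> kp_M c' = 0 \<longleftrightarrow> kp_M c = 0"
    "kh_P c = 0 \<Longrightarrow> kh_K c' = 0 \<longleftrightarrow> kh_K c = 0"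
    using eqs nz zero by auto
  note zero = zero this
  from c[unfolded triplet_list_iff] c'[unfolded triplet_list_iff] show ?thesis
  proof (elim disjE exE bexE conjE)
    fix \<epsilon> \<omega> l \<epsilon>' \<omega>' l'
    assume n: "normal_params \<epsilon> \<omega> l" "normal_params \<epsilon>' \<omega>' l'"
      and eq: "c = g_ambient_coeffs \<epsilon> \<omega> l" "c' = g_ambient_coeffs \<epsilon>' \<omega>' l'"
    \<comment> \<open>Keeping \<open>[K, H] = P\<close> ties \<open>\<pi>\<close> to
      \<open>\<kappa> * \<eta>\<close> and excludes a shift of \<open>P\<close> by \<open>K\<close>,
      so only the scaling of \<open>H\<close> matters.\<close>
    have "l' = \<eta> * l" "\<pi> = \<kappa> * \<eta>" "\<rho> = 0" "\<omega>' * \<pi> = \<eta> * \<pi> * \<omega>" "\<epsilon>' * \<kappa> = \<eta> * \<pi> * \<epsilon>"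
      using eqs unfolding eq by (auto simp: defs)
    then have eq': "l' = \<eta> * l" "\<omega>' = \<eta> * \<omega>" "\<epsilon>' = \<eta>\<^sup>2 * \<epsilon>"
      using nz by (auto simp: power2_eq_square)
    show "c = c'"
      unfolding eq eq' by (simp only: normal_params_unique[OF n(1) n(2)[unfolded eq'] nz(3)])
  next
    fix \<epsilon> \<omega> \<epsilon>' \<omega>'
    assume n: "normal_params \<epsilon> \<omega> \<omega>" "normal_params \<epsilon>' \<omega>' \<omega>'"
      and eq: "c = bargmann_coeffs \<epsilon> \<omega>" "c' = bargmann_coeffs \<epsilon>' \<omega>'"
    have "\<pi> = \<kappa> * \<eta>" "\<rho> = 0" "\<omega>' * \<pi> = \<eta> * \<pi> * \<omega>" "\<epsilon>' * \<kappa> = \<eta> * \<pi> * \<epsilon>"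
      using eqs unfolding eq by (auto simp: defs)
    then have eq': "\<omega>' = \<eta> * \<omega>" "\<epsilon>' = \<eta>\<^sup>2 * \<epsilon>"
      using nz by (auto simp: power2_eq_square)
    show "c = c'"
      unfolding eq eq' by (simp only: normal_params_unique[OF n(1) n(2)[unfolded eq'] nz(3)])
  next
    fix s q s' q' :: real
    assume s: "s \<in> {0, -1, 1}" "s' \<in> {0, -1, 1}" "q \<in> {0, -1, 1}" "q' \<in> {0, -1, 1}"
      and eq: "c = metric_coeffs s q" "c' = metric_coeffs s' q'"
    have "\<eta> = \<kappa> * \<pi>" "s' * \<pi> = \<kappa> * \<eta> * s" "q' * \<kappa> = \<eta> * \<pi> * q"
      using eqs unfolding eq by (auto simp: defs)
    then have "s' = \<kappa>\<^sup>2 * s" "q' = \<pi>\<^sup>2 * q"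
      using nz by (auto simp: power2_eq_square)
    then have "s = s'" "q = q'"
      using sign[OF s(1,2)] sign[OF s(3,4)] nz by blast+
    then show "c = c'"
      unfolding eq by simp
  qed (use zero in \<open>simp_all add: defs del: insert_iff\<close>)
qed

subsection \<open>Changes of basis and the classification\<close>

fun new_basis :: "real \<Rightarrow> real \<Rightarrow> real \<Rightarrow> real \<Rightarrow> real \<Rightarrow> real \<Rightarrow> gen \<Rightarrow> vec" where
  "new_basis \<kappa> \<pi> \<rho> \<eta> \<tau> \<mu> genM = \<mu> *\<^sub>R E genM"
| "new_basis \<kappa> \<pi> \<rho> \<eta> \<tau> \<mu> genH = \<eta> *\<^sub>R E genH + \<tau> *\<^sub>R E genM"
| "new_basis \<kappa> \<pi> \<rho> \<eta> \<tau> \<mu> (genP i) = \<pi> *\<^sub>R E (genP i) + \<rho> *\<^sub>R E (genK i)"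
| "new_basis \<kappa> \<pi> \<rho> \<eta> \<tau> \<mu> (genK i) = \<kappa> *\<^sub>R E (genK i)"
| "new_basis \<kappa> \<pi> \<rho> \<eta> \<tau> \<mu> (genJ i j) = E (genJ i j)"

text \<open>The change is triangular: the new \<open>H\<close> involves \<open>M\<close> and the new
  \<open>P\<close> involves \<open>K\<close>, so spans are preserved for sets closed in this
  sense.\<close>

lemma span_new_basis:
  assumes nz: "\<kappa> \<noteq> 0" "\<pi> \<noteq> 0" "\<eta> \<noteq> 0" "\<mu> \<noteq> 0"
    and S: "genH \<in> S \<Longrightarrow> genM \<in> S" "\<And>i. genP i \<in> S \<Longrightarrow> genK i \<in> S"
  shows "span (new_basis \<kappa> \<pi> \<rho> \<eta> \<tau> \<mu> ` S) = span (E ` S)" (is "span (?e ` S) = _")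
proof (rule span_eq[THEN iffD2], intro conjI image_subsetI)
  have E: "E a \<in> span (E ` S)" if "a \<in> S" for a
    using that by (simp add: span_base)
  fix a assume a: "a \<in> S"
  then show "?e a \<in> span (E ` S)"
    using S by (cases a) (auto intro!: span_add span_scale E)
next
  have e: "?e a \<in> span (?e ` S)" if "a \<in> S" for a
    using that by (simp add: span_base)
  have M: "E genM \<in> span (?e ` S)" if "genM \<in> S"
    using span_scale[OF e[OF that], of "1 / \<mu>"] nz by simp
  have K: "E (genK i) \<in> span (?e ` S)" if "genK i \<in> S" for i
    using span_scale[OF e[OF that], of "1 / \<kappa>"] nz by simp
  fix a assume a: "a \<in> S"
  show "E a \<in> span (?e ` S)"
  proof (cases a)
    case genH
    then have "?e genH \<in> span (?e ` S)" "E genM \<in> span (?e ` S)"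
      using a S(1) M e by blast+
    from span_scale[OF span_diff[OF this(1) span_scale[OF this(2)]], of "1 / \<eta>" \<tau>] show ?thesis
      using genH nz by simp
  next
    case (genP i)
    then have "?e (genP i) \<in> span (?e ` S)" "E (genK i) \<in> span (?e ` S)"
      using a S(2)[of i] K e by blast+
    from span_scale[OF span_diff[OF this(1) span_scale[OF this(2)]], of "1 / \<pi>" \<rho>] show ?thesis
      using genP nz by simp
  qed (use a M K e[of a] in auto)
qed

lemma independent_family_transfer:
  fixes e f :: "'i \<Rightarrow> 'a::real_vector"
  assumes I: "finite I" and e: "inj_on e I" "independent (e ` I)" and f: "span (f ` I) = span (e ` I)"
  shows "inj_on f I" "independent (f ` I)"
proof -
  obtain B where B: "B \<subseteq> f ` I" "independent B" "f ` I \<subseteq> span B"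
    using maximal_independent_subset by blast
  have "finite B"
    using B(1) I finite_subset by blast
  moreover have "e ` I \<subseteq> span B"
    using span_superset[of "e ` I"] f span_minimal[OF B(3) subspace_span] by simp
  ultimately have "card (e ` I) \<le> card B"
    using independent_span_bound[OF _ e(2)] by blast
  then have "card I \<le> card B"
    using e(1) by (simp add: card_image)
  moreover have "card B \<le> card (f ` I)" "card (f ` I) \<le> card I"
    using B(1) I by (simp_all add: card_mono card_image_le)
  ultimately have "card B = card (f ` I)" "card (f ` I) = card I"
    by simp_all
  then show "inj_on f I" "independent (f ` I)"
    using B I card_subset_eq[of "f ` I" B] by (simp_all add: eq_card_imp_inj_on)
qed

section \<open>Realising a coefficient change by a change of basis\<close>

context
  fixes \<kappa> \<pi> \<rho> \<eta> \<tau> \<mu> :: real and c c' :: coeffs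
  assumes adm: "admissible c" "admissible c'"
    and change: "coeff_change \<kappa> \<pi> \<rho> \<eta> \<tau> \<mu> c c'"
    and nz: "\<kappa> \<noteq> 0" "\<pi> \<noteq> 0" "\<eta> \<noteq> 0" "\<mu> \<noteq> 0"
begin

lemma adapted_basis_new_basis: "adapted_basis d (model c d) (new_basis \<kappa> \<pi> \<rho> \<eta> \<tau> \<mu>)"
proof -
  let ?e = "new_basis \<kappa> \<pi> \<rho> \<eta> \<tau> \<mu>"
  have span: "span (?e ` S) = span (E ` S)"
    if "genH \<in> S \<Longrightarrow> genM \<in> S" "\<And>i. genP i \<in> S \<Longrightarrow> genK i \<in> S" for S
    using span_new_basis nz that by blast
  have gens: "span (?e ` gens d) = span (E ` gens d)"
    by (rule span) (auto simp: gens_def)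
  have "frame d (span (E ` gens d)) ?e"
    unfolding frame_def
  proof (intro conjI ballI gens)
    show "inj_on ?e (gens d)" "independent (?e ` gens d)"
      using independent_family_transfer[OF finite_gens _ _ gens] frame_E[of d]
      by (simp_all add: frame_def)
    show "?e (genJ i j) = - ?e (genJ j i)" for i j
      using E_genJ_swap[of i j] by simp
  qed
  then have "ambient_aristotelian d (span (E ` gens d)) (vec_bracket c) ?e"
    unfolding ambient_aristotelian_def
    by (intro conjI ballI lie_algebra_model adm)
      (simp_all add: vec_bracket_E vec_bracket_bilinear_simps algebra_simps)
  then show ?thesis
    using span[of "{genM, genH}"] span[of "Pgens d \<union> Kgens d"] span[of "Jgens d"]
      span[of "Kgens d \<union> Jgens d"] span[of "{genM}"]
    unfolding adapted_basis_def model_def by (auto simp: image_Un)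
qed

text \<open>The rotation coefficients transform like a quadratic form in \<open>K\<close> and
  \<open>P\<close>. Since admissibility expresses them by the other coefficients, this follows from
  the change equations after multiplying by non-zero factors.\<close>

lemma coeff_change_rotations:
  "kk_J c' = \<kappa>\<^sup>2 * kk_J c" "kp_J c' = \<kappa> * \<pi> * kp_J c + \<kappa> * \<rho> * kk_J c"
  "pp_J c' = \<pi>\<^sup>2 * pp_J c + 2 * \<pi> * \<rho> * kp_J c + \<rho>\<^sup>2 * kk_J c"
proof -
  note eqs = change[unfolded coeff_change_def] adm[unfolded admissible_def]
  have "(\<pi> * \<eta>) * kk_J c' = (\<pi> * \<eta>) * (\<kappa>\<^sup>2 * kk_J c)"
    using eqs by algebra
  then show "kk_J c' = \<kappa>\<^sup>2 * kk_J c"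
    using nz by simp
  have "(\<kappa> * \<eta> * \<pi>) * kp_J c' = (\<kappa> * \<eta> * \<pi>) * (\<kappa> * \<pi> * kp_J c + \<kappa> * \<rho> * kk_J c)"
    using eqs by algebra
  then show "kp_J c' = \<kappa> * \<pi> * kp_J c + \<kappa> * \<rho> * kk_J c"
    using nz by simp
  \<comment> \<open>The right-hand side is arranged so that every bracketed term is the left side of
    a change equation.\<close>
  have "(\<kappa> * \<eta> * \<pi>) * pp_J c' = (kp_H c' * \<eta>) *
      (\<pi> * (hp_K c' * \<kappa> + hp_P c' * \<rho>) - \<rho> * (hp_P c' * \<pi>))"
    using adm(2) by (simp add: admissible_def algebra_simps)
  also have "\<dots> = (\<kappa> * \<pi> * kp_H c) * (\<pi> * (\<eta> * \<pi> * hp_K c - \<eta> * \<rho> * kh_K c)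
      - \<rho> * (\<eta> * \<pi> * hp_P c - \<eta> * \<rho> * kh_P c))"
    using change by (simp only: coeff_change_def)
  also have "\<dots> = (\<kappa> * \<eta> * \<pi>) * (\<pi>\<^sup>2 * (kp_H c * hp_K c) - 2 * \<pi> * \<rho> * (kp_H c * kh_K c)
      + \<rho>\<^sup>2 * (kp_H c * kh_P c)) - \<kappa> * \<eta> * \<pi>\<^sup>2 * \<rho> * (kp_H c * (hp_P c - kh_K c))"
    by algebra
  \<comment> \<open>The last term vanishes by the relation between \<open>hp_P c\<close> and
    \<open>kh_K c\<close>.\<close>
  also have "\<dots> = (\<kappa> * \<eta> * \<pi>) * (\<pi>\<^sup>2 * pp_J c + 2 * \<pi> * \<rho> * kp_J c + \<rho>\<^sup>2 * kk_J c)"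
    using adm(1) by (simp add: admissible_def)
  finally show "pp_J c' = \<pi>\<^sup>2 * pp_J c + 2 * \<pi> * \<rho> * kp_J c + \<rho>\<^sup>2 * kk_J c"
    using nz by simp
qed

lemma commutators_new_basis:
  "commutators d (vec_bracket c) (new_basis \<kappa> \<pi> \<rho> \<eta> \<tau> \<mu>) c'"
proof -
  have c: "hm_H c = 0" "mk_K c = 0" "mk_P c = 0" "mp_K c = 0" "mp_P c = 0"
    "hm_H c' = 0" "mk_K c' = 0" "mk_P c' = 0" "mp_K c' = 0" "mp_P c' = 0"
    using adm by (auto simp: admissible_def)
  note eqs = change[unfolded coeff_change_def]
  note simps = vec_bracket_E vec_bracket_bilinear_simps c lookup_add lookup_minus coeff_change_rotations
  let ?e = "new_basis \<kappa> \<pi> \<rho> \<eta> \<tau> \<mu>"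
  have J: "E (genJ i i) = 0" "E (genJ j i) = - E (genJ i j)" for i j
    by (rule E_genJ_refl, rule E_genJ_swap)
  show ?thesis
    unfolding commutators_def
  proof (intro conjI ballI)
    show "vec_bracket c (?e genH) (?e genM) = hm_H c' *\<^sub>R ?e genH + hm_M c' *\<^sub>R ?e genM"
      using eqs by (simp add: simps)
    fix i
    show "vec_bracket c (?e (genK i)) (?e genH) = kh_K c' *\<^sub>R ?e (genK i) + kh_P c' *\<^sub>R ?e (genP i)"
      by (rule poly_mapping_eqI) (simp add: simps del: lookup_E, use eqs in algebra)
    show "vec_bracket c (?e genH) (?e (genP i)) = hp_K c' *\<^sub>R ?e (genK i) + hp_P c' *\<^sub>R ?e (genP i)"
      by (rule poly_mapping_eqI) (simp add: simps del: lookup_E, use eqs in algebra)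
    show "vec_bracket c (?e genM) (?e (genK i)) = mk_K c' *\<^sub>R ?e (genK i) + mk_P c' *\<^sub>R ?e (genP i)"
      "vec_bracket c (?e genM) (?e (genP i)) = mp_K c' *\<^sub>R ?e (genK i) + mp_P c' *\<^sub>R ?e (genP i)"
      by (simp_all add: simps)
    fix j
    define D :: real where "D = kdelta i j"
    have D: "of_bool (i = j) = D" "of_bool (j = i) = D"
      by (auto simp: D_def)
    show "vec_bracket c (?e (genK i)) (?e (genP j)) =
        kdelta i j *\<^sub>R (kp_H c' *\<^sub>R ?e genH + kp_M c' *\<^sub>R ?e genM) + kp_J c' *\<^sub>R ?e (genJ i j)"
      by (rule poly_mapping_eqI) (simp add: simps D del: lookup_E, use eqs in algebra)
    show "vec_bracket c (?e (genK i)) (?e (genK j)) = kk_J c' *\<^sub>R ?e (genJ i j)"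
      by (simp add: simps power2_eq_square)
    show "vec_bracket c (?e (genP i)) (?e (genP j)) = pp_J c' *\<^sub>R ?e (genJ i j)"
      by (rule poly_mapping_eqI) (simp add: simps D J(2)[of j i] del: lookup_E, algebra)
  qed
qed

end

text \<open>Preserving \<open>M\<close>, the scalars, \<open>K\<close> and the vectors makes
  \<open>\<phi>\<close> triangular. The images of the generators form a basis of
  \<open>model c' 1\<close> with commutators \<open>c\<close>, so the change leads from
  \<open>c'\<close> to \<open>c\<close>.\<close>

lemma coeff_change_of_iso:
  assumes adm: "admissible c" "admissible c'" and \<phi>: "triplet_iso \<phi> (model c 1) (model c' 1)"
  obtains \<kappa> \<pi> \<rho> \<eta> \<tau> \<mu> where "\<kappa> \<noteq> 0" "\<pi> \<noteq> 0" "\<eta> \<noteq> 0" "\<mu> \<noteq> 0"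
    "coeff_change \<kappa> \<pi> \<rho> \<eta> \<tau> \<mu> c' c"
proof -
  let ?g = "span (E ` gens 1)"
  let ?M = "E genM" and ?H = "E genH" and ?P = "E (genP 1)" and ?K = "E (genK 1)"
  have g: "?M \<in> ?g" "?H \<in> ?g" "?P \<in> ?g" "?K \<in> ?g"
    by (auto simp: gens_def intro!: span_base)
  have inj: "x = y" if "\<phi> x = \<phi> y" "x \<in> ?g" "y \<in> ?g" for x y
    using \<phi> that by (auto simp: triplet_iso_def bij_betw_def model_def dest: inj_onD)
  have add: "\<phi> (x + y) = \<phi> x + \<phi> y" and br: "\<phi> (vec_bracket c x y) = vec_bracket c' (\<phi> x) (\<phi> y)"
    if "x \<in> ?g" "y \<in> ?g" for x y
    using \<phi> that by (simp_all add: triplet_iso_def model_def)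
  have scale: "\<phi> (r *\<^sub>R x) = r *\<^sub>R \<phi> x" if "x \<in> ?g" for x r
    using \<phi> that by (simp add: triplet_iso_def model_def)
  have zero: "\<phi> 0 = 0"
    using scale[OF g(1), of 0] by simp
  \<comment> \<open>In dimension one there is no rotation, so the isotropy is the line of
    \<open>K\<close>.\<close>
  have one: "Pgens 1 \<union> Kgens 1 = {genP 1, genK 1}" "Kgens 1 \<union> Jgens 1 = {genK 1}"
    by auto
  have images: "\<phi> ?M \<in> span {?M}" "\<phi> ?H \<in> span {?H, ?M}" "\<phi> ?P \<in> span {?P, ?K}" "\<phi> ?K \<in> span {?K}"
  proof -
    have "\<phi> ` span {?M} = span {?M}" "\<phi> ` span {?M, ?H} = span {?M, ?H}"
      "\<phi> ` span (E ` (Pgens 1 \<union> Kgens 1)) = span (E ` (Pgens 1 \<union> Kgens 1))"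
      "\<phi> ` span (E ` (Kgens 1 \<union> Jgens 1)) = span (E ` (Kgens 1 \<union> Jgens 1))"
      using \<phi> by (simp_all add: triplet_iso_def model_def)
    then have eqs: "\<phi> ` span {?M} = span {?M}" "\<phi> ` span {?H, ?M} = span {?H, ?M}"
      "\<phi> ` span {?P, ?K} = span {?P, ?K}" "\<phi> ` span {?K} = span {?K}"
      unfolding one by (simp_all add: insert_commute)
    show "\<phi> ?M \<in> span {?M}" "\<phi> ?H \<in> span {?H, ?M}" "\<phi> ?P \<in> span {?P, ?K}" "\<phi> ?K \<in> span {?K}"
      by (subst eqs[symmetric]; simp add: span_base)+
  qed
  obtain \<mu> where \<mu>: "\<phi> ?M = \<mu> *\<^sub>R ?M"
    using images(1) by (auto simp: span_singleton)
  obtain \<kappa> where \<kappa>: "\<phi> ?K = \<kappa> *\<^sub>R ?K"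
    using images(4) by (auto simp: span_singleton)
  obtain \<eta> \<tau> where \<eta>: "\<phi> ?H = \<eta> *\<^sub>R ?H + \<tau> *\<^sub>R ?M"
    using images(2) by (auto simp: span_breakdown_eq algebra_simps)
  obtain \<pi> \<rho> where \<pi>: "\<phi> ?P = \<pi> *\<^sub>R ?P + \<rho> *\<^sub>R ?K"
    using images(3) by (auto simp: span_breakdown_eq algebra_simps)
  have ne: "?M \<noteq> 0" "?K \<noteq> 0" "?H \<noteq> r *\<^sub>R ?M" "?P \<noteq> r *\<^sub>R ?K" for r
    by (auto dest: arg_cong[where f = "\<lambda>x. Poly_Mapping.lookup x genM"]
      arg_cong[where f = "\<lambda>x. Poly_Mapping.lookup x (genK 1)"]
      arg_cong[where f = "\<lambda>x. Poly_Mapping.lookup x genH"]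
      arg_cong[where f = "\<lambda>x. Poly_Mapping.lookup x (genP 1)"])
  have \<mu>0: "\<mu> \<noteq> 0"
    using inj[of ?M 0] ne(1) \<mu> g zero by (auto simp: span_zero)
  have \<kappa>0: "\<kappa> \<noteq> 0"
    using inj[of ?K 0] ne(2) \<kappa> g zero by (auto simp: span_zero)
  \<comment> \<open>Otherwise \<open>H\<close> would have the same image as a multiple of
    \<open>M\<close>, against injectivity; likewise below for \<open>P\<close> and
    \<open>K\<close>.\<close>
  have \<eta>0: "\<eta> \<noteq> 0"
  proof
    assume "\<eta> = 0"
    then have "\<phi> ?H = \<phi> ((\<tau> / \<mu>) *\<^sub>R ?M)"
      using \<eta> \<mu> \<mu>0 g scale by simp
    then show False
      using inj[of ?H] ne(3) g span_scale by blast
  qed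
  have \<pi>0: "\<pi> \<noteq> 0"
  proof
    assume "\<pi> = 0"
    then have "\<phi> ?P = \<phi> ((\<rho> / \<kappa>) *\<^sub>R ?K)"
      using \<pi> \<kappa> \<kappa>0 g scale by simp
    then show False
      using inj[of ?P] ne(4) g span_scale by blast
  qed
  have c: "hm_H c = 0" "mk_K c = 0" "mk_P c = 0" "mp_K c = 0" "mp_P c = 0"
    "hm_H c' = 0" "mk_K c' = 0" "mk_P c' = 0" "mp_K c' = 0" "mp_P c' = 0"
    using adm by (auto simp: admissible_def)
  note simps = vec_bracket_E vec_bracket_bilinear_simps c add scale g span_scale span_add \<mu> \<kappa> \<eta> \<pi>
    E_genJ_refl
  have eqs: "Poly_Mapping.lookup (\<phi> (vec_bracket c x y)) a
      = Poly_Mapping.lookup (vec_bracket c' (\<phi> x) (\<phi> y)) a" if "x \<in> ?g" "y \<in> ?g" for x y a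
    using br[OF that] by simp
  have "coeff_change \<kappa> \<pi> \<rho> \<eta> \<tau> \<mu> c' c"
    unfolding coeff_change_def
  proof (intro conjI)
    show "hm_M c = \<eta> * hm_M c'"
      using eqs[OF g(2,1), of genM] \<mu>0 by (simp add: simps lookup_add del: One_nat_def)
    show "kh_P c * \<pi> = \<kappa> * \<eta> * kh_P c'"
      using eqs[OF g(4,2), of "genP 1"] by (simp add: simps lookup_add del: One_nat_def)
    show "kh_K c * \<kappa> + kh_P c * \<rho> = \<kappa> * \<eta> * kh_K c'"
      using eqs[OF g(4,2), of "genK 1"] by (simp add: simps lookup_add del: One_nat_def)
    show "hp_P c * \<pi> = \<eta> * \<pi> * hp_P c' - \<eta> * \<rho> * kh_P c'"
      using eqs[OF g(2,3), of "genP 1"] by (simp add: simps lookup_add lookup_minus algebra_simps del: One_nat_def)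
    show "hp_K c * \<kappa> + hp_P c * \<rho> = \<eta> * \<pi> * hp_K c' - \<eta> * \<rho> * kh_K c'"
      using eqs[OF g(2,3), of "genK 1"] by (simp add: simps lookup_add lookup_minus algebra_simps del: One_nat_def)
    show "kp_H c * \<eta> = \<kappa> * \<pi> * kp_H c'"
      using eqs[OF g(4,3), of genH] by (simp add: simps lookup_add del: One_nat_def)
    show "kp_H c * \<tau> + kp_M c * \<mu> = \<kappa> * \<pi> * kp_M c'"
      using eqs[OF g(4,3), of genM] by (simp add: simps lookup_add del: One_nat_def)
  qed
  then show ?thesis
    using that \<kappa>0 \<pi>0 \<eta>0 \<mu>0 by blast
qed

section \<open>Existence and uniqueness of the normal form\<close>

lemma ex_universally_isomorphic:
  assumes "universal_triplet T"
  shows "\<exists>c\<in>triplet_list. universally_isomorphic T (model c)"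
proof -
  obtain c where c: "\<And>d. d \<ge> 1 \<Longrightarrow> \<exists>e. adapted_basis d (T d) e \<and> commutators d (bracket (T d)) e c"
    using assms unfolding universal_triplet_def by blast
  have adm: "admissible c"
    using assms c by (intro admissible_coeffs[of T]) (auto simp: universal_triplet_def)
  \<comment> \<open>The change and \<open>c'\<close> are obtained from \<open>c\<close> alone, hence
    serve every \<open>d\<close> at once.\<close>
  obtain \<kappa> \<pi> \<rho> \<eta> \<tau> \<mu> c' where nz: "\<kappa> \<noteq> 0" "\<pi> \<noteq> 0" "\<eta> \<noteq> 0" "\<mu> \<noteq> 0"
    and c': "c' \<in> triplet_list" "coeff_change \<kappa> \<pi> \<rho> \<eta> \<tau> \<mu> c c'"
    by (rule ex_coeff_change[OF adm])
  have "\<exists>\<phi>. triplet_iso \<phi> (T d) (model c' d)" if d: "d \<ge> 1" for d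
  proof -
    obtain e where "adapted_basis d (T d) e" "commutators d (bracket (T d)) e c"
      using c[OF d] by blast
    then obtain \<phi> where \<phi>: "triplet_iso \<phi> (T d) (model c d)"
      using iso_model by blast
    have "adapted_basis d (model c d) (new_basis \<kappa> \<pi> \<rho> \<eta> \<tau> \<mu>)"
      "commutators d (bracket (model c d)) (new_basis \<kappa> \<pi> \<rho> \<eta> \<tau> \<mu>) c'"
      using adapted_basis_new_basis[OF adm admissible_triplet_list c'(2) nz]
        commutators_new_basis[OF adm admissible_triplet_list c'(2) nz] c'(1) by simp_all
    then obtain \<psi> where "triplet_iso \<psi> (model c d) (model c' d)"
      using iso_model by blast
    then show ?thesis
      using triplet_iso_trans[OF \<phi>] by blast
  qed
  then show ?thesis
    using c'(1) unfolding universally_isomorphic_def by blast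
qed

text \<open>Dimension one decides: going through \<open>T 1\<close> yields an isomorphism between
  two models, hence a coefficient change within the list.\<close>

lemma universally_isomorphic_unique:
  assumes "universal_triplet T" "c \<in> triplet_list" "c' \<in> triplet_list"
    and "universally_isomorphic T (model c)" "universally_isomorphic T (model c')"
  shows "c = c'"
proof -
  obtain \<phi> \<psi> where iso: "triplet_iso \<phi> (T 1) (model c 1)" "triplet_iso \<psi> (T 1) (model c' 1)"
    using assms(4,5) unfolding universally_isomorphic_def by blast
  obtain e where e: "adapted_basis 1 (T 1) e"
    using assms(1) unfolding universal_triplet_def by blast
  obtain \<kappa> \<pi> \<rho> \<eta> \<tau> \<mu> where "\<kappa> \<noteq> 0" "\<pi> \<noteq> 0" "\<eta> \<noteq> 0" "\<mu> \<noteq> 0" "coeff_change \<kappa> \<pi> \<rho> \<eta> \<tau> \<mu> c' c"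
    using coeff_change_of_iso[OF _ _ triplet_iso_trans[OF triplet_iso_sym[OF iso(1) e] iso(2)]]
      assms(2,3) admissible_triplet_list by metis
  then show ?thesis
    using coeff_change_unique[OF assms(3,2)] by metis
qed

lemma ex1_universally_isomorphic:
  assumes "universal_triplet T"
  shows "\<exists>!c. c \<in> triplet_list \<and> universally_isomorphic T (model c)"
proof -
  obtain c where "c \<in> triplet_list" "universally_isomorphic T (model c)"
    using ex_universally_isomorphic[OF assms] by blast
  then show ?thesis
    using universally_isomorphic_unique[OF assms] by (intro ex1I[of _ c]) blast+
qed

theorem theorem5p2:
  shows
    "(\<forall>T :: nat \<Rightarrow> 'a::real_vector triplet. universal_triplet T \<longrightarrow>
        (\<exists>!c. c \<in> triplet_list \<and> universally_isomorphic T (model c))) \<and>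
     (\<forall>c\<in>triplet_list. universal_triplet (model c)) \<and>
     (\<forall>c\<in>g_ambient_family. \<forall>d\<ge>1.
        g_ambient (model c d) (quotient_vec d genM) (\<lambda>v. - H_dual d v) (PP_dual d) (M_dual d)) \<and>
     (\<forall>c\<in>bargmann_family. \<forall>d\<ge>1.
        bargmannian (model c d) (quotient_vec d genM) (\<lambda>v. - H_dual d v) (PP_dual d)
          (\<lambda>v w. - M_dual d v * H_dual d w - H_dual d v * M_dual d w + PP_dual d v w)) \<and>
     (\<forall>c\<in>carroll_family. \<forall>d\<ge>1.
        invariant_vector (model c d) (quotient_vec d genM) \<and>
        invariant_form (model c d) (M_dual d) \<and>
        invariant_vector (model c d) (quotient_vec d genH) \<and>
        invariant_sym_form (model c d) (PP_dual d)) \<and>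
     (\<forall>c\<in>riemann_family. \<forall>d\<ge>1.
        invariant_vector (model c d) (quotient_vec d genM) \<and>
        invariant_form (model c d) (M_dual d) \<and>
        invariant_sym_form (model c d)
          (\<lambda>v w. H_dual d v * H_dual d w + PP_dual d v w)) \<and>
     (\<forall>c\<in>lorentz_family. \<forall>d\<ge>1.
        invariant_vector (model c d) (quotient_vec d genM) \<and>
        invariant_form (model c d) (M_dual d) \<and>
        invariant_sym_form (model c d)
          (\<lambda>v w. - H_dual d v * H_dual d w + PP_dual d v w))"
  by (intro conjI; intro allI ballI impI)
    (simp_all only: universal_triplet_model admissible_triplet_list g_ambient_model
      bargmannian_model carroll_model riemann_model lorentz_model ex1_universally_isomorphic)

end
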